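(* Let $m,c>0$, let $\Omega\subset\mathbb{R}^n$ be open, let $V:\Omega\to\mathbb{R}$ be of class $C^1$, and let $h\in\mathbb{R}$ be such that $\Omega_h=\{x\in\Omega: V(x)+h>0\}\neq\emptyset$. Let $Z_h$, $\Lambda'_h$ and the energy functional $\mathcal{E}_h$ be as defined in the context. Then the following hold. **Part A.** Let $q\in\Lambda'_h$ be a non-constant critical point of $\mathcal{E}_h$ and define $$t(\sigma)=\int_0^\sigma \frac{V(q(\xi))+h+mc^2}{\sqrt{Z_h(q(\xi))+2hm}}\,\frac{|q'(\xi)|}{c^2}\,d\xi,\qquad \sigma\in[0,1].$$ Let $T=t(1)$, let $\varsigma:[0,T]\to[0,1]$ be the inverse of $t$, and define $x(t)=q(\varsigma(t))$ for every $t\in[0,T]$. Then: (1) $x(t)\in\Omega_h$ and $|\dot x(t)|<c$ for every $t\in[0,T]$; (2) $x$ is a periodic solution of $$\frac{\mathrm d}{\mathrm dt}\left(\frac{m\dot x}{\sqrt{1-|\dot x|^2/c^2}}\right)=\nabla V(x);$$ (3) $x$ satisfies $$\frac{mc^2}{\sqrt{1-|\dot x(t)|^2/c^2}}-V(x(t))=h+mc^2,\qquad \forall\, t\in[0,T].$$ **Part B.** Let $x:[0,T]\to\Omega_h$ be a non-constant periodic solution of $$\frac{\mathrm d}{\mathrm dt}\left(\frac{m\dot x}{\sqrt{1-|\dot x|^2/c^2}}\right)=\nabla V(x)$$ satisfying $$\frac{mc^2}{\sqrt{1-|\dot x(t)|^2/c^2}}-V(x(t))=h+mc^2,\qquad \forall\,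 t\in[0,T].$$ Define $$\varpi(t)=\frac{c^2}{\sqrt{2\lambda}}\int_0^t\frac{Z_h(x(\xi))+2hm}{V(x(\xi))+h+mc^2}\,d\xi,\qquad t\in[0,T],$$ where $\lambda>0$ is such that $\varpi(T)=1$. Let $\tau:[0,1]\to[0,T]$ be the inverse of $\varpi$ and define $q(\sigma)=x(\tau(\sigma))$ for every $\sigma\in[0,1]$. Then $q\in\Lambda'_h$ and $q$ is a non-constant critical point of $\mathcal{E}_h$.
   Context: Notation: $|\cdot|$ is the Euclidean norm. For $x\in\Omega_h$, $$Z_h(x)=2mV(x)+\frac1{c^2}(V(x)+h)^2 ,$$ and one has $Z_h(x)+2hm>0$ on $\Omega_h$. The set of admissible loops is $$\Lambda'_h=\{q\in H^1([0,1];\mathbb{R}^n):\ q(0)=q(1),\ q(\sigma)\in\Omega_h\ \ \forall\,\sigma\in[0,1]\},$$ an open subset of the Hilbert space $\{q\in H^1([0,1];\mathbb{R}^n): q(0)=q(1)\}$. The energy functional is $$\mathcal{E}_h(q)=\int_0^1|q'(\sigma)|^2\,(Z_h(q(\sigma))+2hm)\,d\sigma,\qquad q\in\Lambda'_h.$$ A critical point of $\mathcal{E}_h$ is a $q\in\Lambda'_h$ with $d\mathcal{E}_h(q)[v]=0$ for all $v\in H^1([0,1];\mathbb{R}^n)$ with $v(0)=v(1)$. A periodic solution $x$ on $[0,T]$ is a solution of the differential equation (with $|\dot x|<c$) satisfying $x(0)=x(T)$ and $\dot x(0)=\dot x(T)$, i.e. extending to a $T$-periodic solution on $\mathbb{R}$.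 *)

theory Defs
  imports "HOL-Analysis.Analysis"
begin

text \<open>The Sobolev space of the unit interval. A class of functions equal almost everywhere is
  represented by its continuous member, and only the values on \<^term>\<open>{0..1::real}\<close> matter.\<close>

definition test_function :: "(real \<Rightarrow> real) \<Rightarrow> (real \<Rightarrow> real) \<Rightarrow> bool" where
  "test_function \<phi> \<phi>' \<longleftrightarrow>
     (\<forall>s. (\<phi> has_real_derivative \<phi>' s) (at s)) \<and> continuous_on UNIV \<phi>' \<and>
     (\<exists>a b. 0 < a \<and> b < 1 \<and> (\<forall>s. s \<notin> {a..b} \<longrightarrow> \<phi> s = 0))"

definition square_integrable_01 :: "(real \<Rightarrow> 'a::euclidean_space) \<Rightarrow> bool" where
  "square_integrable_01 g \<longleftrightarrow>
     g \<in> borel_measurable (lebesgue_on {0..1}) \<and>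
     integrable (lebesgue_on {0..1}) (\<lambda>s. (norm (g s))\<^sup>2)"

definition is_weak_deriv :: "(real \<Rightarrow> 'a::euclidean_space) \<Rightarrow> (real \<Rightarrow> 'a) \<Rightarrow> bool" where
  "is_weak_deriv q g \<longleftrightarrow>
     square_integrable_01 g \<and>
     (\<forall>\<phi> \<phi>'. test_function \<phi> \<phi>' \<longrightarrow>
        (LINT s|lebesgue_on {0..1}. \<phi>' s *\<^sub>R q s) = - (LINT s|lebesgue_on {0..1}. \<phi> s *\<^sub>R g s))"

definition H1 :: "(real \<Rightarrow> 'a::euclidean_space) set" where
  "H1 = {q. continuous_on {0..1} q \<and> (\<exists>g. is_weak_deriv q g)}"

text \<open>A weak derivative is determined up to a null set, so the choice made here does not affect
  any of the integrals below.\<close>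

definition weak_deriv :: "(real \<Rightarrow> 'a::euclidean_space) \<Rightarrow> real \<Rightarrow> 'a" where
  "weak_deriv q = (SOME g. is_weak_deriv q g)"

definition H1_norm :: "(real \<Rightarrow> 'a::euclidean_space) \<Rightarrow> real" where
  "H1_norm v = sqrt ((LINT s|lebesgue_on {0..1}. (norm (v s))\<^sup>2) +
                     (LINT s|lebesgue_on {0..1}. (norm (weak_deriv v s))\<^sup>2))"

definition H1_loops :: "(real \<Rightarrow> 'a::euclidean_space) set" where
  "H1_loops = {q \<in> H1. q 0 = q 1}"

text \<open>\<open>L\<close> is the Frechet differential at \<open>q \<in> U\<close> of a functional \<open>F\<close> defined on an open
  subset \<open>U\<close> of the Hilbert space \<^const>\<open>H1_loops\<close>.\<close>

definition has_H1_differential ::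
  "((real \<Rightarrow> 'a::euclidean_space) \<Rightarrow> real) \<Rightarrow> ((real \<Rightarrow> 'a) \<Rightarrow> real) \<Rightarrow> (real \<Rightarrow> 'a) set \<Rightarrow> (real \<Rightarrow> 'a) \<Rightarrow> bool"
where
  "has_H1_differential F L U q \<longleftrightarrow>
     (\<forall>u\<in>H1_loops. \<forall>v\<in>H1_loops. L (\<lambda>s. u s + v s) = L u + L v) \<and>
     (\<forall>a. \<forall>v\<in>H1_loops. L (\<lambda>s. a *\<^sub>R v s) = a * L v) \<and>
     (\<exists>K. \<forall>v\<in>H1_loops. \<bar>L v\<bar> \<le> K * H1_norm v) \<and>
     (\<forall>\<epsilon>>0. \<exists>\<delta>>0. \<forall>v\<in>H1_loops. H1_norm v < \<delta> \<and> (\<lambda>s. q s + v s) \<in> U \<longrightarrow>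
        \<bar>F (\<lambda>s. q s + v s) - F q - L v\<bar> \<le> \<epsilon> * H1_norm v)"

definition Omega_h :: "'a set \<Rightarrow> ('a \<Rightarrow> real) \<Rightarrow> real \<Rightarrow> 'a set" where
  "Omega_h \<Omega> V h = {x \<in> \<Omega>. V x + h > 0}"

definition Z_h :: "real \<Rightarrow> real \<Rightarrow> ('a \<Rightarrow> real) \<Rightarrow> real \<Rightarrow> 'a \<Rightarrow> real" where
  "Z_h m c V h x = 2 * m * V x + 1 / c\<^sup>2 * (V x + h)\<^sup>2"

definition Lambda_h :: "'a::euclidean_space set \<Rightarrow> ('a \<Rightarrow> real) \<Rightarrow> real \<Rightarrow> (real \<Rightarrow> 'a) set" where
  "Lambda_h \<Omega> V h = {q \<in> H1. q 0 = q 1 \<and> (\<forall>\<sigma>\<in>{0..1}. q \<sigma> \<in> Omega_h \<Omega> V h)}"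

definition energy_h :: "real \<Rightarrow> real \<Rightarrow> ('a::euclidean_space \<Rightarrow> real) \<Rightarrow> real \<Rightarrow> (real \<Rightarrow> 'a) \<Rightarrow> real" where
  "energy_h m c V h q =
     (LINT \<sigma>|lebesgue_on {0..1}. (norm (weak_deriv q \<sigma>))\<^sup>2 * (Z_h m c V h (q \<sigma>) + 2 * h * m))"

definition critical_point ::
  "real \<Rightarrow> real \<Rightarrow> 'a::euclidean_space set \<Rightarrow> ('a \<Rightarrow> real) \<Rightarrow> real \<Rightarrow> (real \<Rightarrow> 'a) \<Rightarrow> bool" where
  "critical_point m c \<Omega> V h q \<longleftrightarrow>
     q \<in> Lambda_h \<Omega> V h \<and>
     (\<exists>L. has_H1_differential (energy_h m c V h) L (Lambda_h \<Omega> V h) q \<and> (\<forall>v\<in>H1_loops. L v = 0))"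

text \<open>Derivatives of curves on \<^term>\<open>{0..T::real}\<close> are one-sided at the end points.\<close>

definition velocity :: "real \<Rightarrow> (real \<Rightarrow> 'a::euclidean_space) \<Rightarrow> real \<Rightarrow> 'a" where
  "velocity T x t = vector_derivative x (at t within {0..T})"

definition momentum :: "real \<Rightarrow> real \<Rightarrow> real \<Rightarrow> (real \<Rightarrow> 'a::euclidean_space) \<Rightarrow> real \<Rightarrow> 'a" where
  "momentum m c T x t =
     (m / sqrt (1 - (norm (velocity T x t))\<^sup>2 / c\<^sup>2)) *\<^sub>R velocity T x t"

definition periodic_solution ::
  "real \<Rightarrow> real \<Rightarrow> 'a::euclidean_space set \<Rightarrow> ('a \<Rightarrow> 'a) \<Rightarrow> real \<Rightarrow> (real \<Rightarrow> 'a) \<Rightarrow> bool" where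
  "periodic_solution m c \<Omega> gradV T x \<longleftrightarrow>
     0 < T \<and>
     (\<forall>t\<in>{0..T}. x t \<in> \<Omega> \<and> x differentiable (at t within {0..T}) \<and> norm (velocity T x t) < c \<and>
        (momentum m c T x has_vector_derivative gradV (x t)) (at t within {0..T})) \<and>
     x 0 = x T \<and> velocity T x 0 = velocity T x T"

definition energy_conservation ::
  "real \<Rightarrow> real \<Rightarrow> ('a::euclidean_space \<Rightarrow> real) \<Rightarrow> real \<Rightarrow> real \<Rightarrow> (real \<Rightarrow> 'a) \<Rightarrow> bool" where
  "energy_conservation m c V h T x \<longleftrightarrow>
     (\<forall>t\<in>{0..T}. m * c\<^sup>2 / sqrt (1 - (norm (velocity T x t))\<^sup>2 / c\<^sup>2) - V (x t) = h + m * c\<^sup>2)"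

definition time_of ::
  "real \<Rightarrow> real \<Rightarrow> ('a::euclidean_space \<Rightarrow> real) \<Rightarrow> real \<Rightarrow> (real \<Rightarrow> 'a) \<Rightarrow> real \<Rightarrow> real" where
  "time_of m c V h q \<sigma> =
     (LINT \<xi>|lebesgue_on {0..\<sigma>}.
        (V (q \<xi>) + h + m * c\<^sup>2) / sqrt (Z_h m c V h (q \<xi>) + 2 * h * m) *
        (norm (weak_deriv q \<xi>) / c\<^sup>2))"

definition param_of ::
  "real \<Rightarrow> real \<Rightarrow> ('a::euclidean_space \<Rightarrow> real) \<Rightarrow> real \<Rightarrow> real \<Rightarrow> (real \<Rightarrow> 'a) \<Rightarrow> real \<Rightarrow> real" where
  "param_of m c V h lam x t =
     c\<^sup>2 / sqrt (2 * lam) *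
     (LINT \<xi>|lebesgue_on {0..t}.
        (Z_h m c V h (x \<xi>) + 2 * h * m) / (V (x \<xi>) + h + m * c\<^sup>2))"

end

theory Submission
  imports Defs
begin

text \<open>
  Write \<open>W = Z\<^sub>h + 2hm\<close> and \<open>U = V + h + mc\<^sup>2\<close>, so that \<open>c\<^sup>2 W = U\<^sup>2 - (mc\<^sup>2)\<^sup>2\<close> and
  \<open>\<nabla>W = (2U/c\<^sup>2) \<nabla>V\<close>. The functional is Frechet differentiable on loops with differential
  \<open>v \<mapsto> \<integral> 2 W(q) q' \<bullet> v' + \<bar>q'\<bar>\<^sup>2 \<nabla>W(q) \<bullet> v\<close>, and by the du Bois-Reymond argument a critical point is
  \<open>C\<^sup>1\<close> with \<open>(2 W(q) q')' = \<bar>q'\<bar>\<^sup>2 \<nabla>W(q)\<close> and periodic \<open>q'\<close>. Along such a loop \<open>E = W(q) \<bar>q'\<bar>\<^sup>2\<close> is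
  constant, hence \<open>q'\<close> never vanishes if \<open>q\<close> is not constant. The time change makes
  \<open>\<bar>x'\<bar> = c\<^sup>2 \<surd>W / U\<close>, which is energy conservation with Lorentz factor \<open>U / (mc\<^sup>2)\<close>, and turns the
  momentum into \<open>W(q) q' / \<surd>E\<close>, so that the Euler-Lagrange equation and the equation of motion
  are the same equation in two parametrizations.
\<close>

section \<open>Primitives of integrable functions\<close>

text \<open>Low regularity shapes the proof. \<open>weak_deriv\<close> is an arbitrary choice among
  functions that agree almost everywhere, and a loop in \<open>H1\<close> need not have a derivative
  at every point. So the Sobolev space is rewritten as indefinite integrals of square integrable
  functions; there integration by parts holds and the choice made disappears from every integral.
  Since \<open>V\<close> is only C^1, a second order Taylor formula for \<open>W\<close> is not at
  hand; uniform continuity of the gradient on a compact neighbourhood of the loop replaces it. In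
  both directions the momentum \<open>2 W(q) q'\<close> is the regular object, and \<open>q'\<close>
  gets its continuity from it. The differential in \<open>critical_point\<close> is an abstract
  functional. It is compared with the explicit expansion of the energy along small multiples of a
  variation, which stay inside \<open>Omega_h\<close> because the sup norm is at most
  \<open>2 * H1_norm\<close>. The number \<open>lam\<close> is not arbitrary either: the loop built
  from a solution has \<open>E = 2 * lam\<close>, and with this value the two time changes are
  inverse to each other.\<close>

lemma sigma_finite_lebesgue: "sigma_finite_measure (lebesgue :: 'a::euclidean_space measure)"
proof -
  obtain A :: "'a set set" where "countable A" "A \<subseteq> sets lborel" "\<Union>A = space lborel"
    "\<forall>a\<in>A. emeasure lborel a \<noteq> \<infinity>"
    using lborel.sigma_finite_countable by blast
  then show ?thesis
    by (intro sigma_finite_measure.intro exI[of _ A]) auto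
qed

text \<open>Subtraction passes from initial segments to all intervals, closed intervals generate the
  Borel sets, and Lebesgue sets are Borel up to null sets; a function with zero integral over every
  measurable set vanishes almost everywhere. This yields uniqueness of weak derivatives.\<close>

lemma absolutely_integrable_integral_eq_0_imp_AE_0:
  fixes f :: "real \<Rightarrow> 'a::euclidean_space"
  assumes f: "f absolutely_integrable_on {a..b}"
    and zero: "\<And>s. s \<in> {a..b} \<Longrightarrow> integral {a..s} f = 0"
  shows "AE s in lebesgue_on {a..b}. f s = 0"
proof -
  define F where "F \<equiv> \<lambda>x. if x \<in> {a..b} then f x else 0"
  have F_eq: "F = (\<lambda>x. indicator {a..b} x *\<^sub>R f x)"
    by (auto simp: F_def indicator_def)
  have F: "integrable lebesgue F"
    using f unfolding F_eq set_integrable_def .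
  have Fset: "set_integrable lebesgue A F" if "A \<in> sets lebesgue" for A
    unfolding set_integrable_def using integrable_mult_indicator[OF that F] .
  have interval: "(LINT x:{u..v}|lebesgue. F x) = 0" if "u \<le> v" for u v
  proof -
    define u' v' where "u' = max a u" and "v' = min b v"
    have "(LINT x:{u..v}|lebesgue. F x) = integral {u..v} F"
      by (intro set_lebesgue_integral_eq_integral Fset) auto
    also have "\<dots> = integral {u'..v'} f"
    proof -
      have "integral {u..v} F = integral ({a..b} \<inter> {u..v}) f"
        unfolding F_def by (rule integral_restrict_Int)
      also have "{a..b} \<inter> {u..v} = {u'..v'}" by (auto simp: u'_def v'_def)
      finally show ?thesis .
    qed
    also have "\<dots> = 0"
    proof (cases "u' \<le> v'")
      case True
      then have uv: "u' \<in> {a..b}" "v' \<in> {a..b}" by (auto simp: u'_def v'_def)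
      have "f integrable_on {a..v'}"
        by (rule integrable_subinterval_real[OF absolutely_integrable_on_def[THEN iffD1, OF f, THEN conjunct1]])
          (use uv in auto)
      then have "integral {a..u'} f + integral {u'..v'} f = integral {a..v'} f"
        using True uv by (intro Henstock_Kurzweil_Integration.integral_combine) auto
      with zero uv show ?thesis by simp
    qed auto
    finally show ?thesis .
  qed
  have UNIV0: "(LINT x|lebesgue. F x) = 0"
  proof -
    have "(LINT x|lebesgue. F x) = (LINT x:{a..b}|lebesgue. F x)"
      unfolding set_lebesgue_integral_def by (rule Bochner_Integration.integral_cong) (auto simp: F_def)
    also have "\<dots> = 0" using interval[of a b] by (cases "a \<le> b") (auto simp: set_lebesgue_integral_def)
    finally show ?thesis .
  qed
  \<comment> \<open>Induction over the Borel sets from closed intervals: complements use the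
    vanishing total integral \<open>UNIV0\<close>, disjoint unions use countable additivity.\<close>
  have borel: "(LINT x:A|lebesgue. F x) = 0" if "A \<in> sets borel" for A
    using that
  proof (induction rule: borel_set_induct)
    case empty
    then show ?case by (simp add: set_lebesgue_integral_def)
  next
    case (interval u v)
    then show ?case using \<open>\<And>v u. u \<le> v \<Longrightarrow> (LINT x:{u..v}|lebesgue. F x) = 0\<close> by simp
  next
    case (compl A)
    then have A: "A \<in> sets lebesgue" by simp
    have "(LINT x:A \<union> -A|lebesgue. F x) = (LINT x:A|lebesgue. F x) + (LINT x:-A|lebesgue. F x)"
      using A by (intro set_integral_Un Fset) (auto intro: sets.compl_sets simp: Compl_eq_Diff_UNIV)
    with compl UNIV0 show ?case by (simp add: set_lebesgue_integral_def)
  next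
    case (union A)
    then have A: "A i \<in> sets lebesgue" for i by simp
    have "(LINT x:(\<Union>i. A i)|lebesgue. F x) = (\<Sum>i. (LINT x:(A i)|lebesgue. F x))"
    proof (rule lebesgue_integral_countable_add)
      show "set_integrable lebesgue (\<Union>i. A i) F"
        using A by (intro Fset) auto
    qed (use union A in \<open>auto simp: disjoint_family_on_def\<close>)
    with union show ?case by simp
  qed
  have "AE x in lebesgue. F x = 0"
  proof (rule sigma_finite_measure.density_zero[OF sigma_finite_lebesgue F])
    fix A :: "real set" assume A: "A \<in> sets lebesgue"
    then obtain S N N' where SN: "A = S \<union> N" "N \<subseteq> N'" "N' \<in> null_sets lborel" "S \<in> sets lborel"
      by (auto elim: sets_completionE)
    have "AE x in lebesgue. x \<notin> N'"
      using SN(3) by (intro AE_not_in) (auto intro: null_sets_completionI)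
    then have "AE x in lebesgue. x \<in> A \<longleftrightarrow> x \<in> S"
      by eventually_elim (use SN in auto)
    then have "(LINT x:A|lebesgue. F x) = (LINT x:S|lebesgue. F x)"
      using A SN(4) F by (intro set_integral_cong_set)
        (auto simp: set_borel_measurable_def intro!: borel_measurable_scaleR borel_measurable_indicator)
    with borel SN(4) show "(LINT x:A|lebesgue. F x) = 0" by simp
  qed
  then show ?thesis
    by (subst AE_restrict_space_iff) (auto simp: F_def elim: eventually_mono)
qed

text \<open>Absolute continuity in integral form. The function \<open>f'\<close> matters only up to
  null sets, and no pointwise derivative of \<open>f\<close> is asked for.\<close>

definition primitive_on :: "real \<Rightarrow> real \<Rightarrow> (real \<Rightarrow> 'a::euclidean_space) \<Rightarrow> (real \<Rightarrow> 'a) \<Rightarrow> bool" where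
  "primitive_on a b f' f \<longleftrightarrow>
     f' absolutely_integrable_on {a..b} \<and> (\<forall>s\<in>{a..b}. f s = f a + integral {a..s} f')"

lemma primitive_onI:
  assumes "f' absolutely_integrable_on {a..b}"
    and "\<And>s. s \<in> {a..b} \<Longrightarrow> f s = f a + integral {a..s} f'"
  shows "primitive_on a b f' f"
  using assms unfolding primitive_on_def by blast

lemma primitive_onD:
  assumes "primitive_on a b f' f"
  shows "f' absolutely_integrable_on {a..b}"
    and "\<And>s. s \<in> {a..b} \<Longrightarrow> f s = f a + integral {a..s} f'"
  using assms unfolding primitive_on_def by blast+

lemma absolutely_integrable_on_subintervalI:
  fixes f :: "real \<Rightarrow> 'a::euclidean_space"
  assumes "f absolutely_integrable_on {a..b}" "a \<le> s" "t \<le> b"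
  shows "f absolutely_integrable_on {s..t}"
  using assms by (auto intro!: absolutely_integrable_on_subinterval)

lemma primitive_on_diff:
  assumes "primitive_on a b f' f" "a \<le> s" "s \<le> t" "t \<le> b"
  shows "f t - f s = integral {s..t} f'"
proof -
  have "f' integrable_on {a..t}"
    using absolutely_integrable_on_subintervalI[OF primitive_onD(1)[OF assms(1)], of a t] assms
    by (auto simp: absolutely_integrable_on_def)
  then have "integral {a..s} f' + integral {s..t} f' = integral {a..t} f'"
    using assms by (intro Henstock_Kurzweil_Integration.integral_combine) auto
  moreover have "s \<in> {a..b}" "t \<in> {a..b}" using assms by auto
  note this[THEN primitive_onD(2)[OF assms(1)]]
  ultimately show ?thesis
    by (metis add_diff_cancel_left add_diff_cancel_left')
qed

lemma primitive_on_continuous: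
  assumes "primitive_on a b f' f"
  shows "continuous_on {a..b} f"
proof -
  have "f' integrable_on {a..b}"
    using primitive_onD(1)[OF assms] by (simp add: absolutely_integrable_on_def)
  then have "continuous_on {a..b} (\<lambda>s. f a + integral {a..s} f')"
    by (intro continuous_intros indefinite_integral_continuous_1)
  then show ?thesis
    by (rule continuous_on_eq) (rule primitive_onD(2)[OF assms, symmetric])
qed

lemma primitive_on_indefinite_integral:
  assumes "f absolutely_integrable_on {a..b}"
  shows "primitive_on a b f (\<lambda>s. c + integral {a..s} f)"
  unfolding primitive_on_def using assms by simp

lemma primitive_on_of_has_vector_derivative:
  fixes f :: "real \<Rightarrow> 'a::euclidean_space"
  assumes "\<And>s. s \<in> {a..b} \<Longrightarrow> (f has_vector_derivative f' s) (at s within {a..b})"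
    and "continuous_on {a..b} f'"
  shows "primitive_on a b f' f"
proof (rule primitive_onI)
  show "f' absolutely_integrable_on {a..b}"
    using assms(2) by (rule absolutely_integrable_continuous_real)
  fix s assume s: "s \<in> {a..b}"
  have "(f' has_integral f s - f a) {a..s}"
  proof (rule fundamental_theorem_of_calculus)
    fix x assume "x \<in> {a..s}"
    then show "(f has_vector_derivative f' x) (at x within {a..s})"
      using s by (auto intro!: has_vector_derivative_within_subset[OF assms(1)])
  qed (use s in auto)
  then show "f s = f a + integral {a..s} f'" by (simp add: integral_unique)
qed

lemma primitive_on_has_vector_derivative:
  fixes f :: "real \<Rightarrow> 'a::euclidean_space"
  assumes "primitive_on a b f' f" "continuous_on {a..b} f'" "s \<in> {a..b}"
  shows "(f has_vector_derivative f' s) (at s within {a..b})"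
proof -
  have "((\<lambda>s. f a + integral {a..s} f') has_vector_derivative 0 + f' s) (at s within {a..b})"
    by (intro has_vector_derivative_add has_vector_derivative_const integral_has_vector_derivative assms)
  then show ?thesis
    using has_vector_derivative_transform[OF assms(3) primitive_onD(2)[OF assms(1)]] by simp
qed

lemma absolutely_integrable_bounded_bilinear:
  fixes f :: "real \<Rightarrow> 'a::euclidean_space" and g :: "real \<Rightarrow> 'b::euclidean_space"
    and prod :: "'a \<Rightarrow> 'b \<Rightarrow> 'c::euclidean_space"
  assumes "bounded_bilinear prod" "continuous_on {a..b} f" "g absolutely_integrable_on {a..b}"
  shows "(\<lambda>s. prod (f s) (g s)) absolutely_integrable_on {a..b}"
proof (rule absolutely_integrable_bounded_measurable_product[of prod])
  show "f \<in> borel_measurable (lebesgue_on {a..b})"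
    using assms(2) by (intro continuous_imp_measurable_on_sets_lebesgue) auto
  show "bounded (f ` {a..b})"
    using assms(2) by (intro compact_imp_bounded compact_continuous_image) auto
qed (use assms in \<open>auto simp: bilinear_conv_bounded_bilinear\<close>)

lemma integral_norm_le_primitive:
  fixes f :: "real \<Rightarrow> 'a::euclidean_space"
  assumes "primitive_on a b f' f" "a \<le> s" "s \<le> t" "t \<le> b"
  shows "norm (f t - f s) \<le> integral {s..t} (\<lambda>\<xi>. norm (f' \<xi>))"
proof -
  have "f' absolutely_integrable_on {s..t}"
    using absolutely_integrable_on_subintervalI[OF primitive_onD(1)[OF assms(1)]] assms by auto
  then show ?thesis
    unfolding primitive_on_diff[OF assms]
    by (intro integral_norm_bound_integral) (auto simp: absolutely_integrable_on_def)
qed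

lemma primitive_on_norm_integral:
  fixes f' :: "real \<Rightarrow> 'a::euclidean_space"
  assumes "f' absolutely_integrable_on {a..b}"
  shows "primitive_on a b (\<lambda>s. norm (f' s)) (\<lambda>s. integral {a..s} (\<lambda>\<xi>. norm (f' \<xi>)))"
  using primitive_on_indefinite_integral[where f = "\<lambda>s. norm (f' s)" and c = 0,
      OF absolutely_integrable_norm[OF assms, unfolded o_def]]
  by simp

text \<open>The defect \<open>D\<close> of the product rule has increments of second order,
  \<open>\<bar>D t - D s\<bar> \<le> 2 K (A t - A s) (B t - B s)\<close> with continuous monotone \<open>A\<close> and \<open>B\<close>, so
  it is constant; this avoids Fubini's theorem.\<close>

lemma primitive_on_bounded_bilinear:
  fixes f :: "real \<Rightarrow> 'a::euclidean_space" and g :: "real \<Rightarrow> 'b::euclidean_space"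
    and prod :: "'a \<Rightarrow> 'b \<Rightarrow> 'c::euclidean_space"
  assumes prod: "bounded_bilinear prod" and ab: "a \<le> b"
    and f: "primitive_on a b f' f" and g: "primitive_on a b g' g"
  shows "(\<lambda>s. prod (f s) (g' s)) absolutely_integrable_on {a..b}"
    and "(\<lambda>s. prod (f' s) (g s)) absolutely_integrable_on {a..b}"
    and "integral {a..b} (\<lambda>s. prod (f s) (g' s)) + integral {a..b} (\<lambda>s. prod (f' s) (g s)) =
         prod (f b) (g b) - prod (f a) (g a)"
proof -
  interpret bounded_bilinear prod by fact
  have flip: "bounded_bilinear (\<lambda>x y. prod y x)" by (rule flip)
  note f' = primitive_onD(1)[OF f] and g' = primitive_onD(1)[OF g]
  have fg'_int: "(\<lambda>s. prod (u s) (g' s)) absolutely_integrable_on {a..b}" 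
    if "continuous_on {a..b} u" for u
    by (rule absolutely_integrable_bounded_bilinear[OF prod that g'])
  have f'g_int: "(\<lambda>s. prod (f' s) (u s)) absolutely_integrable_on {a..b}" 
    if "continuous_on {a..b} u" for u
    by (rule absolutely_integrable_bounded_bilinear[OF flip that f'])
  note cont = primitive_on_continuous[OF f] primitive_on_continuous[OF g]
  show 1: "(\<lambda>s. prod (f s) (g' s)) absolutely_integrable_on {a..b}"
    and 2: "(\<lambda>s. prod (f' s) (g s)) absolutely_integrable_on {a..b}"
    by (intro fg'_int f'g_int cont)+
  define \<phi> where "\<phi> \<equiv> \<lambda>s. prod (f s) (g' s) + prod (f' s) (g s)"
  define D where "D \<equiv> \<lambda>s. prod (f s) (g s) - integral {a..s} \<phi>"
  define A where "A \<equiv> \<lambda>s. integral {a..s} (\<lambda>\<xi>. norm (f' \<xi>))"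
  define B where "B \<equiv> \<lambda>s. integral {a..s} (\<lambda>\<xi>. norm (g' \<xi>))"
  have A: "primitive_on a b (\<lambda>s. norm (f' s)) A" and B: "primitive_on a b (\<lambda>s. norm (g' s)) B"
    unfolding A_def B_def by (rule primitive_on_norm_integral f' g')+
  obtain K where K: "K > 0" "\<And>x y. norm (prod x y) \<le> norm x * norm y * K"
    using pos_bounded by blast
  have A_mono: "A s \<le> A t" if "a \<le> s" "s \<le> t" "t \<le> b" for s t
    using primitive_on_diff[OF A that] integral_nonneg[of "\<lambda>s. norm (f' s)" "{s..t}"]
      absolutely_integrable_on_subintervalI[OF f', of s t] that
    by (simp add: absolutely_integrable_on_def)
  have B_mono: "B s \<le> B t" if "a \<le> s" "s \<le> t" "t \<le> b" for s t
    using primitive_on_diff[OF B that] integral_nonneg[of "\<lambda>s. norm (g' s)" "{s..t}"]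
      absolutely_integrable_on_subintervalI[OF g', of s t] that
    by (simp add: absolutely_integrable_on_def)
  have fA: "norm (f t - f s) \<le> A t - A s" if "a \<le> s" "s \<le> t" "t \<le> b" for s t
    using integral_norm_le_primitive[OF f that] primitive_on_diff[OF A that] by simp
  have gB: "norm (g t - g s) \<le> B t - B s" if "a \<le> s" "s \<le> t" "t \<le> b" for s t
    using integral_norm_le_primitive[OF g that] primitive_on_diff[OF B that] by simp
  have \<phi>: "\<phi> absolutely_integrable_on {a..b}"
    unfolding \<phi>_def using 1 2 by (rule set_integral_add)
  have incr: "norm (D t - D s) \<le> 2 * K * (A t - A s) * (B t - B s)" if st: "a \<le> s" "s \<le> t" "t \<le> b" for s t
  proof -
    have sub: "u integrable_on {s..t}" if "u absolutely_integrable_on {a..b}" for u :: "real \<Rightarrow> 'x::euclidean_space"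
      using absolutely_integrable_on_subintervalI[OF that, of s t] st
      by (simp add: absolutely_integrable_on_def)
    define R where "R \<equiv> \<lambda>\<xi>. prod (f \<xi> - f s) (g' \<xi>) + prod (f' \<xi>) (g \<xi> - g t)"
    have int: "(\<lambda>\<xi>. prod (f \<xi> - f s) (g' \<xi>)) integrable_on {s..t}"
      "(\<lambda>\<xi>. prod (f' \<xi>) (g \<xi> - g t)) integrable_on {s..t}"
      by (intro sub fg'_int f'g_int continuous_intros cont)+
    note norms = sub[OF absolutely_integrable_norm[OF f', unfolded o_def]]
      sub[OF absolutely_integrable_norm[OF g', unfolded o_def]]
    have g's: "(g' has_integral (g t - g s)) {s..t}" and f's: "(f' has_integral (f t - f s)) {s..t}"
      unfolding primitive_on_diff[OF g st] primitive_on_diff[OF f st]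
      using sub[OF g'] sub[OF f'] by auto
    have "((\<lambda>\<xi>. R \<xi> + (prod (f s) (g' \<xi>) + prod (f' \<xi>) (g t))) has_integral 
        integral {s..t} R + (prod (f s) (g t - g s) + prod (f t - f s) (g t))) {s..t}"
    proof (intro has_integral_add)
      show "(R has_integral integral {s..t} R) {s..t}"
        unfolding R_def using int by (intro integrable_integral integrable_add)
      show "((\<lambda>\<xi>. prod (f s) (g' \<xi>)) has_integral prod (f s) (g t - g s)) {s..t}"
        using has_integral_linear[OF g's bounded_linear_right[of "f s"]] by (simp add: o_def)
      show "((\<lambda>\<xi>. prod (f' \<xi>) (g t)) has_integral prod (f t - f s) (g t)) {s..t}"
        using has_integral_linear[OF f's bounded_linear_left[of "g t"]] by (simp add: o_def)
    qed
    also have "(\<lambda>\<xi>. R \<xi> + (prod (f s) (g' \<xi>) + prod (f' \<xi>) (g t))) = \<phi>"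
      by (auto simp: R_def \<phi>_def diff_left diff_right)
    finally have "integral {s..t} \<phi> = integral {s..t} R + (prod (f t) (g t) - prod (f s) (g s))"
      by (simp add: integral_unique diff_left diff_right)
    moreover have "integral {a..t} \<phi> = integral {a..s} \<phi> + integral {s..t} \<phi>"
      using primitive_on_diff[OF primitive_on_indefinite_integral[OF \<phi>, of 0] st]
      by (simp add: algebra_simps)
    ultimately have DR: "D t - D s = - integral {s..t} R"
      by (simp add: D_def)
    have "norm (integral {s..t} R) \<le> integral {s..t} (\<lambda>\<xi>. K * (A t - A s) * norm (g' \<xi>) + K * (B t - B s) * norm (f' \<xi>))"
    proof (rule integral_norm_bound_integral)
      show "R integrable_on {s..t}" unfolding R_def using int by (intro integrable_add)
      show "(\<lambda>\<xi>. K * (A t - A s) * norm (g' \<xi>) + K * (B t - B s) * norm (f' \<xi>)) integrable_on {s..t}"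
        by (intro integrable_add integrable_on_mult_right norms)
      fix \<xi> assume \<xi>: "\<xi> \<in> {s..t}"
      have "norm (prod (f \<xi> - f s) (g' \<xi>)) \<le> (A t - A s) * norm (g' \<xi>) * K"
        using fA[of s \<xi>] A_mono[of \<xi> t] \<xi> st K(1)
        by (intro order_trans[OF K(2)] mult_right_mono) auto
      moreover have "norm (prod (f' \<xi>) (g \<xi> - g t)) \<le> norm (f' \<xi>) * (B t - B s) * K"
        using gB[of \<xi> t] B_mono[of s \<xi>] \<xi> st K(1)
        by (intro order_trans[OF K(2)] mult_right_mono mult_left_mono) (auto simp: norm_minus_commute)
      ultimately show "norm (R \<xi>) \<le> K * (A t - A s) * norm (g' \<xi>) + K * (B t - B s) * norm (f' \<xi>)"
        unfolding R_def by (intro order_trans[OF norm_triangle_ineq]) (simp add: algebra_simps)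
    qed
    also have "\<dots> = K * (A t - A s) * (B t - B s) + K * (B t - B s) * (A t - A s)"
      unfolding primitive_on_diff[OF A st] primitive_on_diff[OF B st]
      by (subst integral_add)
        (auto intro!: integrable_on_mult_right norms)
    finally show ?thesis unfolding DR by (simp add: algebra_simps)
  qed
  have "norm (D b - D a) \<le> \<epsilon> * (B b - B a)" if "\<epsilon> > 0" for \<epsilon>
  proof -
    \<comment> \<open>Of the two small factors, the increment of \<open>A\<close> is made uniformly
      smaller than \<open>\<delta>\<close>; the increment of \<open>B\<close> is kept, because it
      adds up over a subdivision.\<close>
    define \<delta> where "\<delta> = \<epsilon> / (2 * K)"
    have \<delta>: "\<delta> > 0" "2 * K * \<delta> = \<epsilon>" using that K by (auto simp: \<delta>_def)
    have "uniformly_continuous_on {a..b} A"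
      using primitive_on_continuous[OF A] by (intro compact_uniformly_continuous) auto
    then obtain d where d: "d > 0" "\<And>s t. s \<in> {a..b} \<Longrightarrow> t \<in> {a..b} \<Longrightarrow> dist t s < d \<Longrightarrow> dist (A t) (A s) < \<delta>"
      unfolding uniformly_continuous_on_def using \<delta>(1) by metis
    have "a \<le> a \<and> b \<le> b \<longrightarrow> norm (D b - D a) \<le> \<epsilon> * (B b - B a)"
    \<comment> \<open>Bisection: the estimate is additive in adjacent intervals and holds on all
      short ones, so it holds on the whole interval.\<close>
    proof (rule Bolzano[OF ab, of "\<lambda>s t. a \<le> s \<and> t \<le> b \<longrightarrow> norm (D t - D s) \<le> \<epsilon> * (B t - B s)"])
      fix r s t :: real
      assume *: "a \<le> r \<and> s \<le> b \<longrightarrow> norm (D s - D r) \<le> \<epsilon> * (B s - B r)"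
        "a \<le> s \<and> t \<le> b \<longrightarrow> norm (D t - D s) \<le> \<epsilon> * (B t - B s)" "r \<le> s" "s \<le> t"
      have "norm (D t - D r) \<le> norm (D t - D s) + norm (D s - D r)"
        using norm_triangle_ineq[of "D t - D s" "D s - D r"] by simp
      with * show "a \<le> r \<and> t \<le> b \<longrightarrow> norm (D t - D r) \<le> \<epsilon> * (B t - B r)"
        by (auto simp: algebra_simps)
    next
      fix x assume x: "a \<le> x" "x \<le> b"
      have "norm (D t - D s) \<le> \<epsilon> * (B t - B s)" if st: "s \<le> x" "x \<le> t" "t - s < d" "a \<le> s" "t \<le> b" for s t
      proof -
        have "A t - A s \<le> \<delta>"
          using d(2)[of s t] st by (auto simp: dist_real_def)
        then have "2 * K * (A t - A s) * (B t - B s) \<le> 2 * K * \<delta> * (B t - B s)"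
          using K(1) B_mono[of s t] st by (intro mult_right_mono mult_left_mono) auto
        then show ?thesis using incr[of s t] st \<delta> by auto
      qed
      then show "\<exists>d>0. \<forall>s t. s \<le> x \<and> x \<le> t \<and> t - s < d \<longrightarrow>
          (a \<le> s \<and> t \<le> b \<longrightarrow> norm (D t - D s) \<le> \<epsilon> * (B t - B s))"
        using d(1) by blast
    qed
    then show ?thesis by simp
  qed
  note small = this
  have "norm (D b - D a) \<le> 0"
  proof (rule field_le_epsilon)
    fix e :: real assume e: "e > 0"
    have nn: "B b - B a \<ge> 0" using B_mono[of a b] ab by auto
    \<comment> \<open>The added 1 keeps the denominator positive when
      \<open>B b = B a\<close>.\<close>
    have "norm (D b - D a) \<le> e / (B b - B a + 1) * (B b - B a)"
      using e nn by (intro small) auto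
    also have "\<dots> \<le> e" using e nn by (simp add: field_simps)
    finally show "norm (D b - D a) \<le> 0 + e" by simp
  qed
  then have "D b = D a" by simp
  moreover have "integral {a..b} \<phi> = integral {a..b} (\<lambda>s. prod (f s) (g' s)) + integral {a..b} (\<lambda>s. prod (f' s) (g s))"
    unfolding \<phi>_def using 1 2 by (intro integral_add) (auto simp: absolutely_integrable_on_def)
  ultimately show "integral {a..b} (\<lambda>s. prod (f s) (g' s)) + integral {a..b} (\<lambda>s. prod (f' s) (g s)) =
         prod (f b) (g b) - prod (f a) (g a)"
    by (simp add: D_def algebra_simps)
qed

section \<open>The Sobolev space as the space of primitives of square integrable functions\<close>

lemma lebesgue_integral_eq_integral_01:
  fixes f :: "real \<Rightarrow> 'a::euclidean_space"
  assumes "f absolutely_integrable_on {0..1}"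
  shows "(LINT s|lebesgue_on {0..1}. f s) = integral {0..1} f"
  using assms by (intro lebesgue_integral_eq_integral absolutely_integrable_imp_integrable) auto

section \<open>Test functions and the du Bois-Reymond lemma\<close>

lemma test_function_zero:
  assumes "test_function \<phi> \<phi>'"
  shows "\<phi> 0 = 0" "\<phi> 1 = 0"
  using assms unfolding test_function_def by (meson atLeastAtMost_iff not_le)+

lemma test_function_primitive_on:
  assumes "test_function \<phi> \<phi>'"
  shows "primitive_on a b \<phi>' \<phi>"
  using assms unfolding test_function_def
  by (intro primitive_on_of_has_vector_derivative)
    (auto simp: has_real_derivative_iff_has_vector_derivative intro: continuous_on_subset
      has_vector_derivative_at_within)

lemma integral_test_function_deriv_scaleR:
  fixes f :: "real \<Rightarrow> 'a::euclidean_space"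
  assumes "test_function \<phi> \<phi>'" "primitive_on 0 1 f' f"
  shows "integral {0..1} (\<lambda>s. \<phi>' s *\<^sub>R f s) = - integral {0..1} (\<lambda>s. \<phi> s *\<^sub>R f' s)"
  using primitive_on_bounded_bilinear(3)[OF bounded_bilinear_scaleR _
      test_function_primitive_on[OF assms(1)] assms(2)] test_function_zero[OF assms(1)]
  by (simp add: eq_neg_iff_add_eq_0 add.commute)

lemma is_weak_deriv_of_primitive_on:
  fixes f :: "real \<Rightarrow> 'a::euclidean_space"
  assumes "square_integrable_01 f'" "primitive_on 0 1 f' f"
  shows "is_weak_deriv f f'"
  unfolding is_weak_deriv_def
proof (intro conjI allI impI assms)
  fix \<phi> \<phi>' :: "real \<Rightarrow> real"
  assume \<phi>: "test_function \<phi> \<phi>'"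
  note parts = primitive_on_bounded_bilinear[OF bounded_bilinear_scaleR _
      test_function_primitive_on[OF \<phi>] assms(2)]
  show "(LINT s|lebesgue_on {0..1}. \<phi>' s *\<^sub>R f s) = - (LINT s|lebesgue_on {0..1}. \<phi> s *\<^sub>R f' s)"
    using parts(1,2) integral_test_function_deriv_scaleR[OF \<phi> assms(2)]
    by (simp add: lebesgue_integral_eq_integral_01)
qed

text \<open>Zero mean brings the primitive back to 0 to the right of \<open>b\<close>, so it has
  support inside the open unit interval. This is the source of all test functions used
  below.\<close>

lemma test_function_indefinite_integral:
  fixes \<psi> :: "real \<Rightarrow> real"
  assumes cont: "continuous_on UNIV \<psi>" and supp: "\<And>s. s \<notin> {a<..<b} \<Longrightarrow> \<psi> s = 0"
    and ab: "0 < a" "a < b" "b < 1" and zero: "integral {0..1} \<psi> = 0"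
  shows "test_function (\<lambda>s. integral {0..s} \<psi>) \<psi>"
proof -
  have int: "\<psi> integrable_on {u..v}" for u v
    using cont by (intro integrable_continuous_real) (auto intro: continuous_on_subset)
  have left: "integral {0..s} \<psi> = 0" if "s \<le> a" for s
    using that supp by (intro integral_unique has_integral_is_0) auto
  have right: "integral {0..s} \<psi> = 0" if "s \<ge> b" for s
  proof -
    have "integral {0..b} \<psi> + integral {b..u} \<psi> = integral {0..u} \<psi>" if "u \<ge> b" for u
      using ab that int by (intro Henstock_Kurzweil_Integration.integral_combine) auto
    moreover have "integral {b..u} \<psi> = 0" for u
      using supp by (intro integral_unique has_integral_is_0) auto
    ultimately have "integral {0..u} \<psi> = integral {0..b} \<psi>" if "u \<ge> b" for u
      using that by force
    from this[OF that] this[of 1] zero ab show ?thesis by simp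
  qed
  have deriv: "((\<lambda>s. integral {0..s} \<psi>) has_real_derivative \<psi> s) (at s)" for s
  \<comment> \<open>To the left of \<open>a\<close> the primitive is identically 0, also for
    negative \<open>s\<close>, where \<open>{0..s}\<close> is empty. Otherwise \<open>s\<close> is
    interior to \<open>{0..s+1}\<close> and the one-sided derivative is a full one.\<close>
  proof (cases "s < a")
    case True
    have "((\<lambda>s. 0) has_real_derivative 0) (at s)" by simp
    then have "((\<lambda>s. integral {0..s} \<psi>) has_real_derivative 0) (at s)"
      by (rule has_field_derivative_transform_within_open[where S = "{..<a}"])
        (use True left in auto)
    then show ?thesis using supp[of s] True by simp
  next
    case False
    have "((\<lambda>s. integral {0..s} \<psi>) has_real_derivative \<psi> s) (at s within {0..s+1})"
      using False ab cont
      by (intro integral_has_real_derivative) (auto intro: continuous_on_subset)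
    moreover have "at s within {0..s+1} = at s"
      using False ab by (intro at_within_interior) auto
    ultimately show ?thesis by simp
  qed
  then show ?thesis
    unfolding test_function_def using cont left right ab
    by (intro conjI exI[of _ a] exI[of _ b]) (auto simp: not_le)
qed

text \<open>Testing against \<open>\<phi>' = \<eta> (e - M)\<close>, where \<open>\<eta>\<close> is a bump and \<open>M\<close> the \<open>\<eta>\<close>-weighted mean of \<open>e\<close>,
  gives \<open>\<integral> \<eta> (e - M)\<^sup>2 = 0\<close>.\<close>

lemma du_bois_reymond_continuous:
  fixes e :: "real \<Rightarrow> real"
  assumes cont: "continuous_on {0..1} e"
    and test: "\<And>\<phi> \<phi>'. test_function \<phi> \<phi>' \<Longrightarrow> integral {0..1} (\<lambda>s. \<phi>' s * e s) = 0"
    and s: "s \<in> {0..1}"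
  shows "e s = e 0"
proof -
  have const: "\<exists>M. \<forall>s\<in>{a<..<b}. e s = M" if ab: "0 < a" "a < b" "b < 1" for a b
  proof -
    \<comment> \<open>A merely continuous bump is enough: it enters as a factor of
      \<open>\<phi>'\<close>, which has to be continuous and no more.\<close>
    define \<eta> :: "real \<Rightarrow> real" where "\<eta> \<equiv> \<lambda>s. max 0 ((s - a) * (b - s))"
    have \<eta>: "continuous_on A \<eta>" "\<And>s. \<eta> s \<ge> 0" "\<And>s. s \<notin> {a<..<b} \<Longrightarrow> \<eta> s = 0"
      "\<And>s. s \<in> {a<..<b} \<Longrightarrow> \<eta> s > 0" for A
      unfolding \<eta>_def using ab by (auto intro!: continuous_intros max_absorb1 simp: mult_le_0_iff less_max_iff_disj not_less)
    \<comment> \<open>Clamping the argument extends \<open>e\<close> continuously to the line, since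
      the derivative of a test function must be continuous everywhere.\<close>
    define \<eta>e where "\<eta>e \<equiv> \<lambda>s. e (max 0 (min 1 s))"
    have ext: "continuous_on A \<eta>e" for A
      unfolding \<eta>e_def by (intro continuous_on_compose2[OF cont] continuous_intros) auto
    have ext_eq: "\<eta>e s = e s" if "s \<in> {0..1}" for s
      using that by (auto simp: \<eta>e_def max_def min_def)
    define M where "M = integral {0..1} (\<lambda>s. \<eta> s * \<eta>e s) / integral {0..1} \<eta>"
    have int: "f integrable_on {0..1}" if "continuous_on UNIV f" for f :: "real \<Rightarrow> real"
      using that by (intro integrable_continuous_real) (auto intro: continuous_on_subset)
    have "integral {0..1} \<eta> \<noteq> 0"
    proof -
      have "(a + b) / 2 \<in> {0..1}" "\<eta> ((a + b) / 2) \<noteq> 0"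
        using \<eta>(4)[of "(a + b) / 2"] ab by auto
      then show ?thesis using integral_eq_0_iff[OF \<eta>(1), of 0 1] \<eta>(2) by auto
    qed
    then have "integral {0..1} (\<lambda>s. \<eta> s * \<eta>e s) - M * integral {0..1} \<eta> = 0"
      by (simp add: M_def)
    moreover define \<psi> where "\<psi> \<equiv> \<lambda>s. \<eta> s * (\<eta>e s - M)"
    have "integral {0..1} \<psi> = integral {0..1} (\<lambda>s. \<eta> s * \<eta>e s) - integral {0..1} (\<lambda>s. \<eta> s * M)"
      unfolding \<psi>_def right_diff_distrib
      by (intro Henstock_Kurzweil_Integration.integral_diff int continuous_intros \<eta> ext)
    ultimately have \<psi>0: "integral {0..1} \<psi> = 0" by (simp add: mult.commute)
    have \<psi>c: "continuous_on A \<psi>" for A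
      unfolding \<psi>_def by (intro continuous_intros \<eta> ext)
    have "test_function (\<lambda>s. integral {0..s} \<psi>) \<psi>"
      by (rule test_function_indefinite_integral[OF \<psi>c _ ab \<psi>0]) (simp add: \<psi>_def \<eta>(3))
    from test[OF this] have "integral {0..1} (\<lambda>s. \<psi> s * \<eta>e s) = 0"
      by (subst Henstock_Kurzweil_Integration.integral_cong[where g = "\<lambda>s. \<psi> s * e s"]) (auto simp: ext_eq)
    moreover have "integral {0..1} (\<lambda>s. \<psi> s * \<eta>e s - \<psi> s * M) =
        integral {0..1} (\<lambda>s. \<psi> s * \<eta>e s) - integral {0..1} (\<lambda>s. \<psi> s * M)"
      by (intro Henstock_Kurzweil_Integration.integral_diff int continuous_intros \<psi>c ext)
    moreover have "integral {0..1} (\<lambda>s. \<psi> s * M) = 0" using \<psi>0 by simp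
    moreover have "(\<lambda>s. \<psi> s * \<eta>e s - \<psi> s * M) = (\<lambda>s. \<eta> s * (\<eta>e s - M)\<^sup>2)"
      by (simp add: \<psi>_def fun_eq_iff power2_eq_square algebra_simps)
    ultimately have "integral {0..1} (\<lambda>s. \<eta> s * (\<eta>e s - M)\<^sup>2) = 0" by simp
    then have "\<forall>s\<in>{0..1}. \<eta> s * (\<eta>e s - M)\<^sup>2 = 0"
      by (subst (asm) integral_eq_0_iff) (auto intro!: continuous_intros \<eta> ext mult_nonneg_nonneg)
    then have "e s = M" if "s \<in> {a<..<b}" for s
    proof -
      have "s \<in> {0..1}" using that ab by auto
      then show ?thesis
        using \<open>\<forall>s\<in>{0..1}. \<eta> s * (\<eta>e s - M)\<^sup>2 = 0\<close> \<eta>(4)[OF that] ext_eq[of s] by fastforce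
    qed
    then show ?thesis by blast
  qed
  have "e u = e (1/2)" if "u \<in> {0<..<1}" for u
  proof -
    \<comment> \<open>An interval that contains both \<open>u\<close> and \<open>1/2\<close> and
      stays away from 0 and 1, so that the local constants for different \<open>u\<close>
      coincide.\<close>
    define a b where "a = min u (1/2) / 2" and "b = (1 + max u (1/2)) / 2"
    have ab: "0 < a" "a < b" "b < 1" "u \<in> {a<..<b}" "1/2 \<in> {a<..<b}"
      using that by (auto simp: a_def b_def min_def max_def)
    then show ?thesis using const[of a b] by metis
  qed
  note inner = this
  have closure: "closure {0<..<1::real} = {0..1}" by simp
  have "e u = e (1/2)" if "u \<in> {0..1}" for u
    by (rule continuous_constant_on_closure[of "{0<..<1::real}", unfolded closure, OF cont inner that])
  from this[OF s] this[of 0] show ?thesis by simp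
qed

text \<open>On an interval of finite length the pointwise bound \<open>x \<le> 1 + x^2\<close> makes
  square integrability the stronger property.\<close>

lemma square_integrable_01_imp_absolutely_integrable:
  assumes "square_integrable_01 g"
  shows "g absolutely_integrable_on {0..1}"
proof (rule measurable_bounded_by_integrable_imp_absolutely_integrable)
  show "g \<in> borel_measurable (lebesgue_on {0..1})"
    using assms by (simp add: square_integrable_01_def)
  have "(\<lambda>s. (norm (g s))\<^sup>2) integrable_on {0..1}"
    using assms by (intro integrable_on_lebesgue_on) (auto simp: square_integrable_01_def)
  then show "(\<lambda>s. 1 + (norm (g s))\<^sup>2) integrable_on {0..1}"
    by (intro integrable_add integrable_const_ivl)
  show "norm (g s) \<le> 1 + (norm (g s))\<^sup>2" for s
    using sum_squares_bound[of "norm (g s)" 1] zero_le_power2[of "norm (g s)"] norm_ge_zero[of "g s"]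
    unfolding power_one mult_1_right by linarith
qed auto

text \<open>If \<open>G\<close> is a primitive of \<open>g\<close>, then \<open>q - G\<close> has
  weak derivative zero, and du Bois-Reymond applied to each coordinate makes it constant. Together
  with \<open>is_weak_deriv_of_primitive_on\<close> this identifies weak derivatives with
  integrands.\<close>

lemma primitive_on_of_is_weak_deriv:
  fixes q :: "real \<Rightarrow> 'a::euclidean_space"
  assumes cont: "continuous_on {0..1} q" and weak: "is_weak_deriv q g"
  shows "primitive_on 0 1 g q"
proof -
  have g: "g absolutely_integrable_on {0..1}"
    using weak square_integrable_01_imp_absolutely_integrable by (auto simp: is_weak_deriv_def)
  define G where "G \<equiv> \<lambda>s. integral {0..s} g"
  have G: "primitive_on 0 1 g G"
    using primitive_on_indefinite_integral[OF g, of 0] by (simp add: G_def)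
  note Gc = primitive_on_continuous[OF G]
  have test: "integral {0..1} (\<lambda>s. \<phi>' s *\<^sub>R (q s - G s)) = 0" if \<phi>: "test_function \<phi> \<phi>'" for \<phi> \<phi>'
  proof -
    have \<phi>': "continuous_on {0..1} \<phi>'" and \<phi>c: "continuous_on {0..1} \<phi>"
      using \<phi> primitive_on_continuous[OF test_function_primitive_on[OF \<phi>]]
      by (auto simp: test_function_def intro: continuous_on_subset)
    have "integral {0..1} (\<lambda>s. \<phi>' s *\<^sub>R q s) = - integral {0..1} (\<lambda>s. \<phi> s *\<^sub>R g s)"
      using weak \<phi> unfolding is_weak_deriv_def
      using lebesgue_integral_eq_integral_01[OF absolutely_integrable_bounded_bilinear[OF bounded_bilinear_scaleR \<phi>c g]]
        lebesgue_integral_eq_integral_01[of "\<lambda>s. \<phi>' s *\<^sub>R q s", OF absolutely_integrable_continuous_real]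
        continuous_on_scaleR[OF \<phi>' cont]
      by auto
    also have "\<dots> = integral {0..1} (\<lambda>s. \<phi>' s *\<^sub>R G s)"
      using integral_test_function_deriv_scaleR[OF \<phi> G] by simp
    finally show ?thesis
      unfolding scaleR_diff_right
      by (subst Henstock_Kurzweil_Integration.integral_diff)
        (auto intro!: integrable_continuous_real continuous_intros cont Gc \<phi>')
  qed
  have const: "q s - G s = q 0 - G 0" if s: "s \<in> {0..1}" for s
  proof (rule euclidean_eqI)
    fix i :: 'a assume "i \<in> Basis"
    show "(q s - G s) \<bullet> i = (q 0 - G 0) \<bullet> i"
    proof (rule du_bois_reymond_continuous[OF _ _ s])
      show "continuous_on {0..1} (\<lambda>s. (q s - G s) \<bullet> i)"
        by (intro continuous_intros cont Gc)
      fix \<phi> \<phi>' assume \<phi>: "test_function \<phi> \<phi>'"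
      have \<phi>': "continuous_on {0..1} \<phi>'"
        using \<phi> by (auto simp: test_function_def intro: continuous_on_subset)
      have "((\<lambda>s. \<phi>' s *\<^sub>R (q s - G s)) has_integral 0) {0..1}"
        using test[OF \<phi>] by (subst has_integral_iff)
          (auto intro!: integrable_continuous_real continuous_intros cont Gc \<phi>')
      from has_integral_linear[OF this bounded_linear_inner_left[of i]]
      show "integral {0..1} (\<lambda>s. \<phi>' s * ((q s - G s) \<bullet> i)) = 0"
        by (simp add: o_def integral_unique)
    qed
  qed
  show ?thesis
  proof (rule primitive_onI[OF g])
    fix s :: real assume "s \<in> {0..1}"
    from const[OF this] show "q s = q 0 + integral {0..s} g"
      by (simp add: G_def algebra_simps)
  qed
qed

lemma primitive_on_unique_AE:
  fixes q :: "real \<Rightarrow> 'a::euclidean_space"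
  assumes "primitive_on a b g q" "primitive_on a b k q"
  shows "AE s in lebesgue_on {a..b}. g s = k s"
proof -
  note gk = primitive_onD(1)[OF assms(1)] primitive_onD(1)[OF assms(2)]
  have "AE s in lebesgue_on {a..b}. g s - k s = 0"
  proof (rule absolutely_integrable_integral_eq_0_imp_AE_0)
    show "(\<lambda>s. g s - k s) absolutely_integrable_on {a..b}"
      using gk by (rule set_integral_diff)
    fix s assume s: "s \<in> {a..b}"
    have "u integrable_on {a..s}" if "u absolutely_integrable_on {a..b}" for u :: "real \<Rightarrow> 'a"
      using absolutely_integrable_on_subintervalI[OF that, of a s] s
      by (simp add: absolutely_integrable_on_def)
    then have "integral {a..s} (\<lambda>s. g s - k s) = integral {a..s} g - integral {a..s} k"
      using gk by (intro Henstock_Kurzweil_Integration.integral_diff) auto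
    also have "\<dots> = 0"
      using primitive_onD(2)[OF assms(1) s] primitive_onD(2)[OF assms(2) s]
      by (metis add_left_cancel right_minus_eq)
    finally show "integral {a..s} (\<lambda>s. g s - k s) = 0" .
  qed
  then show ?thesis by simp
qed

text \<open>Admits every representative of the derivative, so explicit ones (of sums, of multiples,
  or continuous ones) can be used instead of the chosen \<open>weak_deriv q\<close>.\<close>

definition H1_deriv :: "(real \<Rightarrow> 'a::euclidean_space) \<Rightarrow> (real \<Rightarrow> 'a) \<Rightarrow> bool" where
  "H1_deriv q g \<longleftrightarrow> square_integrable_01 g \<and> primitive_on 0 1 g q"

lemma H1_derivD:
  assumes "H1_deriv q g"
  shows "square_integrable_01 g" "primitive_on 0 1 g q" "g \<in> borel_measurable (lebesgue_on {0..1})"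
    "integrable (lebesgue_on {0..1}) (\<lambda>s. (norm (g s))\<^sup>2)" "continuous_on {0..1} q"
  using assms primitive_on_continuous by (auto simp: H1_deriv_def square_integrable_01_def)

lemma H1_deriv_imp_H1:
  assumes "H1_deriv q g"
  shows "q \<in> H1"
  using assms is_weak_deriv_of_primitive_on primitive_on_continuous
  by (fastforce simp: H1_def H1_deriv_def)

lemma H1_deriv_weak_deriv:
  assumes "q \<in> H1"
  shows "H1_deriv q (weak_deriv q)"
proof -
  have "is_weak_deriv q (weak_deriv q)"
    unfolding weak_deriv_def using assms someI_ex[of "is_weak_deriv q"] by (auto simp: H1_def)
  then show ?thesis
    using assms primitive_on_of_is_weak_deriv by (auto simp: H1_def H1_deriv_def is_weak_deriv_def)
qed

lemma weak_deriv_AE_eq: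
  assumes "H1_deriv q g"
  shows "AE s in lebesgue_on {0..1}. weak_deriv q s = g s"
  using primitive_on_unique_AE[OF _ H1_derivD(2)[OF assms]]
    H1_derivD(2)[OF H1_deriv_weak_deriv[OF H1_deriv_imp_H1[OF assms]]] by blast

section \<open>Algebra of square integrable functions and of Sobolev functions\<close>

lemma integrable_inner_square_integrable:
  assumes "square_integrable_01 f" "square_integrable_01 g"
  shows "integrable (lebesgue_on {0..1}) (\<lambda>s. f s \<bullet> g s)"
proof (rule Bochner_Integration.integrable_bound)
  show "integrable (lebesgue_on {0..1}) (\<lambda>s. (norm (f s))\<^sup>2 + (norm (g s))\<^sup>2)"
    using assms by (auto simp: square_integrable_01_def)
  show "(\<lambda>s. f s \<bullet> g s) \<in> borel_measurable (lebesgue_on {0..1})"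
    using assms by (auto simp: square_integrable_01_def)
  \<comment> \<open>Only integrability of the product is at stake, not the size of its integral, so
    this crude pointwise bound can stand in for Hoelder's inequality.\<close>
  have "\<bar>f s \<bullet> g s\<bar> \<le> (norm (f s))\<^sup>2 + (norm (g s))\<^sup>2" for s
    using Cauchy_Schwarz_ineq2[of "f s" "g s"] sum_squares_bound[of "norm (f s)" "norm (g s)"]
      mult_nonneg_nonneg[of "norm (f s)" "norm (g s)"] by (simp del: mult_nonneg_nonneg)
  then show "AE s in lebesgue_on {0..1}. norm (f s \<bullet> g s) \<le> norm ((norm (f s))\<^sup>2 + (norm (g s))\<^sup>2)"
    by auto
qed

lemma square_integrable_01_add:
  assumes "square_integrable_01 f" "square_integrable_01 g"
  shows "square_integrable_01 (\<lambda>s. f s + g s)"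
proof -
  have "integrable (lebesgue_on {0..1}) (\<lambda>s. (norm (f s))\<^sup>2 + 2 * (f s \<bullet> g s) + (norm (g s))\<^sup>2)"
    using assms integrable_inner_square_integrable[OF assms] by (auto simp: square_integrable_01_def)
  moreover have "(\<lambda>s. (norm (f s))\<^sup>2 + 2 * (f s \<bullet> g s) + (norm (g s))\<^sup>2) = (\<lambda>s. (norm (f s + g s))\<^sup>2)"
    by (simp add: power2_norm_eq_inner inner_add_left inner_add_right inner_commute algebra_simps)
  ultimately show ?thesis
    using assms by (auto simp: square_integrable_01_def)
qed

lemma square_integrable_01_scaleR:
  assumes "square_integrable_01 f"
  shows "square_integrable_01 (\<lambda>s. c *\<^sub>R f s)"
  using assms by (auto simp: square_integrable_01_def power_mult_distrib)

lemma integrable_bounded_times: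
  fixes u f :: "real \<Rightarrow> real"
  assumes "continuous_on {a..b} u" "integrable (lebesgue_on {a..b}) f"
  shows "integrable (lebesgue_on {a..b}) (\<lambda>s. u s * f s)"
proof -
  have "f absolutely_integrable_on {a..b}"
    using assms(2) by (simp add: integrable_restrict_space set_integrable_def)
  then show ?thesis
    using absolutely_integrable_bounded_bilinear[OF bounded_bilinear_mult assms(1)]
    by (intro absolutely_integrable_imp_integrable) auto
qed

lemma square_integrable_01_times_continuous:
  assumes "continuous_on {0..1} u" "square_integrable_01 f"
  shows "square_integrable_01 (\<lambda>s. u s *\<^sub>R f s)"
proof -
  have "integrable (lebesgue_on {0..1}) (\<lambda>s. (u s)\<^sup>2 * (norm (f s))\<^sup>2)"
    using assms by (intro integrable_bounded_times continuous_intros) (auto simp: square_integrable_01_def)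
  moreover have "u \<in> borel_measurable (lebesgue_on {0..1})"
    using assms(1) by (intro continuous_imp_measurable_on_sets_lebesgue) auto
  ultimately show ?thesis
    using assms(2) by (auto simp: square_integrable_01_def power_mult_distrib)
qed

lemma square_integrable_01_continuous:
  fixes f :: "real \<Rightarrow> 'a::euclidean_space"
  assumes "continuous_on {0..1} f"
  shows "square_integrable_01 f"
  unfolding square_integrable_01_def
  using assms by (auto intro!: continuous_imp_measurable_on_sets_lebesgue
      continuous_imp_integrable_real continuous_intros)

lemma H1_deriv_add:
  assumes "H1_deriv q g" "H1_deriv v w"
  shows "H1_deriv (\<lambda>s. q s + v s) (\<lambda>s. g s + w s)"
proof -
  note prim = H1_derivD(2)[OF assms(1)] H1_derivD(2)[OF assms(2)]
  note abs = prim[THEN primitive_onD(1)]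
  have "primitive_on 0 1 (\<lambda>s. g s + w s) (\<lambda>s. q s + v s)"
  proof (rule primitive_onI[OF set_integral_add(1)[OF abs]])
    fix s :: real assume s: "s \<in> {0..1}"
    have "u integrable_on {0..s}" if "u absolutely_integrable_on {0..1}" for u :: "real \<Rightarrow> 'a"
      using absolutely_integrable_on_subintervalI[OF that, of 0 s] s
      by (simp add: absolutely_integrable_on_def)
    with abs have "integral {0..s} (\<lambda>s. g s + w s) = integral {0..s} g + integral {0..s} w"
      by (intro integral_add) auto
    then show "q s + v s = q 0 + v 0 + integral {0..s} (\<lambda>s. g s + w s)"
      using arg_cong2[of _ _ _ _ "(+)", OF primitive_onD(2)[OF prim(1) s] primitive_onD(2)[OF prim(2) s]]
      by (simp only: add_ac)
  qed
  then show ?thesis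
    using square_integrable_01_add H1_derivD(1) assms by (auto simp: H1_deriv_def)
qed

lemma H1_deriv_scaleR:
  assumes "H1_deriv v w"
  shows "H1_deriv (\<lambda>s. c *\<^sub>R v s) (\<lambda>s. c *\<^sub>R w s)"
proof -
  note prim = H1_derivD(2)[OF assms]
  have "primitive_on 0 1 (\<lambda>s. c *\<^sub>R w s) (\<lambda>s. c *\<^sub>R v s)"
  proof (rule primitive_onI)
    show "(\<lambda>s. c *\<^sub>R w s) absolutely_integrable_on {0..1}"
      using primitive_onD(1)[OF prim] by auto
    fix s :: real assume s: "s \<in> {0..1}"
    show "c *\<^sub>R v s = c *\<^sub>R v 0 + integral {0..s} (\<lambda>s. c *\<^sub>R w s)"
      using primitive_onD(2)[OF prim s] by (metis integral_cmul scaleR_right_distrib)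
  qed
  then show ?thesis
    using square_integrable_01_scaleR H1_derivD(1) assms by (auto simp: H1_deriv_def)
qed

section \<open>The Sobolev norm and its control of the sup norm\<close>

lemma H1_norm_eq:
  assumes "H1_deriv v w"
  shows "H1_norm v = sqrt ((LINT s|lebesgue_on {0..1}. (norm (v s))\<^sup>2) +
                           (LINT s|lebesgue_on {0..1}. (norm (w s))\<^sup>2))"
proof -
  note wv = H1_deriv_weak_deriv[OF H1_deriv_imp_H1[OF assms]]
  have "(LINT s|lebesgue_on {0..1}. (norm (weak_deriv v s))\<^sup>2) = (LINT s|lebesgue_on {0..1}. (norm (w s))\<^sup>2)"
    using weak_deriv_AE_eq[OF assms] H1_derivD(3)[OF assms] H1_derivD(3)[OF wv]
    by (intro integral_cong_AE) auto
  then show ?thesis by (simp add: H1_norm_def)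
qed

lemma H1_norm_nonneg [simp]: "H1_norm v \<ge> 0"
  by (simp add: H1_norm_def)

lemma H1_norm_scaleR:
  assumes "H1_deriv v w"
  shows "H1_norm (\<lambda>s. c *\<^sub>R v s) = \<bar>c\<bar> * H1_norm v"
proof -
  have "sqrt (c\<^sup>2 * x + c\<^sup>2 * y) = \<bar>c\<bar> * sqrt (x + y)" for x y
    by (simp add: real_sqrt_mult flip: distrib_left)
  then show ?thesis
    by (simp add: H1_norm_eq[OF assms] H1_norm_eq[OF H1_deriv_scaleR[OF assms]] power_mult_distrib)
qed

lemma LINT_norm_square_le_H1_norm:
  assumes "H1_deriv v w"
  shows "(LINT s|lebesgue_on {0..1}. (norm (w s))\<^sup>2) \<le> (H1_norm v)\<^sup>2"
    and "(LINT s|lebesgue_on {0..1}. (norm (v s))\<^sup>2) \<le> (H1_norm v)\<^sup>2"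
  by (simp_all add: H1_norm_eq[OF assms])

text \<open>Cauchy-Schwarz against the constant 1, obtained by integrating
  \<open>x \<le> x^2 / (2 * a) + a / 2\<close>. The choice \<open>a = N\<close> would be optimal;
  \<open>a = N + e\<close> stays positive when \<open>N = 0\<close>.\<close>

lemma LINT_norm_le_sqrt:
  assumes f: "square_integrable_01 f" and le: "(LINT s|lebesgue_on {0..1}. (norm (f s))\<^sup>2) \<le> N\<^sup>2" and N: "N \<ge> 0"
  shows "integral {0..1} (\<lambda>s. norm (f s)) \<le> N"
proof (rule field_le_epsilon)
  fix e :: real assume e: "e > 0"
  define a where "a = N + e"
  have a: "a > 0" "N\<^sup>2 \<le> a\<^sup>2" using e N by (auto simp: a_def intro: power_mono)
  have f2: "(\<lambda>s. (norm (f s))\<^sup>2) integrable_on {0..1}"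
    using f by (intro integrable_on_lebesgue_on) (auto simp: square_integrable_01_def)
  have eq: "(LINT s|lebesgue_on {0..1}. (norm (f s))\<^sup>2) = integral {0..1} (\<lambda>s. (norm (f s))\<^sup>2)"
    using f by (intro lebesgue_integral_eq_integral) (auto simp: square_integrable_01_def)
  have "integral {0..1} (\<lambda>s. norm (f s)) \<le> integral {0..1} (\<lambda>s. (norm (f s))\<^sup>2 * (1 / (2 * a)) + a / 2)"
  proof (rule integral_le)
    show "(\<lambda>s. norm (f s)) integrable_on {0..1}"
      using square_integrable_01_imp_absolutely_integrable[OF f] by (simp add: absolutely_integrable_on_def)
    show "(\<lambda>s. (norm (f s))\<^sup>2 * (1 / (2 * a)) + a / 2) integrable_on {0..1}"
      using f2 by (intro integrable_add integrable_const_ivl integrable_on_mult_left)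
    show "norm (f s) \<le> (norm (f s))\<^sup>2 * (1 / (2 * a)) + a / 2" for s
      using a(1) sum_squares_bound[of "norm (f s)" a] by (simp add: field_simps power2_eq_square)
  qed
  also have "\<dots> = integral {0..1} (\<lambda>s. (norm (f s))\<^sup>2) * (1 / (2 * a)) + a / 2"
    by (subst integral_add[OF integrable_on_mult_left[OF f2] integrable_const_ivl]) simp
  also have "\<dots> \<le> a\<^sup>2 * (1 / (2 * a)) + a / 2"
    using le a unfolding eq by (intro add_right_mono mult_right_mono) auto
  also have "\<dots> = N + e" using a(1) by (simp add: a_def power2_eq_square field_simps)
  finally show "integral {0..1} (\<lambda>s. norm (f s)) \<le> N + e" .
qed

text \<open>The value at \<open>s\<close> is at most the value at any \<open>r\<close> plus the
  total variation; averaging over \<open>r\<close> bounds it by the mean of \<open>norm v\<close>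
  plus the integral of \<open>norm w\<close>. Each of these is at most \<open>H1_norm v\<close>,
  whence the factor 2.\<close>

lemma norm_le_H1_norm:
  assumes v: "H1_deriv v w" and s: "s \<in> {0..1}"
  shows "norm (v s) \<le> 2 * H1_norm v"
proof -
  note vc = H1_derivD(5)[OF v]
  have w: "w absolutely_integrable_on {0..1}"
    using primitive_onD(1)[OF H1_derivD(2)[OF v]] .
  have w1: "integral {0..1} (\<lambda>s. norm (w s)) \<le> H1_norm v"
    using LINT_norm_le_sqrt[OF H1_derivD(1)[OF v] LINT_norm_square_le_H1_norm(1)[OF v]] by simp
  have v1: "integral {0..1} (\<lambda>s. norm (v s)) \<le> H1_norm v"
    using LINT_norm_le_sqrt[OF square_integrable_01_continuous[OF vc] LINT_norm_square_le_H1_norm(2)[OF v]] by simp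
  have sub: "integral {x..y} (\<lambda>s. norm (w s)) \<le> H1_norm v" if "0 \<le> x" "y \<le> 1" for x y
  proof -
    have "integral {x..y} (\<lambda>s. norm (w s)) \<le> integral {0..1} (\<lambda>s. norm (w s))"
      using w absolutely_integrable_on_subintervalI[OF w, of x y] that
      by (intro integral_subset_le) (auto simp: absolutely_integrable_on_def)
    with w1 show ?thesis by simp
  qed
  have diff: "norm (v s) \<le> norm (v r) + H1_norm v" if r: "r \<in> {0..1}" for r
  proof -
    have "norm (v s - v r) \<le> H1_norm v"
    proof (cases "r \<le> s")
      case True
      then show ?thesis
        using integral_norm_le_primitive[OF H1_derivD(2)[OF v], of r s] sub[of r s] r s by auto
    next
      case False
      then show ?thesis
        using integral_norm_le_primitive[OF H1_derivD(2)[OF v], of s r] sub[of s r] r s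
        by (auto simp: norm_minus_commute)
    qed
    then show ?thesis using norm_triangle_ineq2[of "v s" "v r"] by linarith
  qed
  have "integral {0..1::real} (\<lambda>r. norm (v s)) \<le> integral {0..1} (\<lambda>r. norm (v r) + H1_norm v)"
    using diff by (intro integral_le integrable_continuous_real continuous_intros vc) auto
  also have "\<dots> = integral {0..1} (\<lambda>r. norm (v r)) + H1_norm v"
    by (subst integral_add) (auto intro!: integrable_continuous_real continuous_intros vc)
  finally show ?thesis using v1 by simp
qed

section \<open>First variation of a weighted energy\<close>

lemma AE_lebesgue_on_imp_negligible:
  assumes "AE x in lebesgue_on S. P x" "S \<in> sets lebesgue"
  shows "negligible {x \<in> S. \<not> P x}"
proof -
  have "AE x in lebesgue. x \<in> S \<longrightarrow> P x"
    using assms by (simp add: AE_restrict_space_iff)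
  then show ?thesis
    unfolding completion.AE_iff_null_sets negligible_iff_null_sets
    by (auto simp: Collect_conj_eq)
qed

lemma integral_AE_cong_subinterval:
  fixes f g :: "real \<Rightarrow> 'a::euclidean_space"
  assumes "AE x in lebesgue_on {a..b}. f x = g x" "s \<le> b"
  shows "integral {a..s} f = integral {a..s} g"
  by (rule integral_spike[OF AE_lebesgue_on_imp_negligible[OF assms(1)]]) (use assms(2) in auto)

lemma primitive_on_AE_cong:
  fixes f :: "real \<Rightarrow> 'a::euclidean_space"
  assumes "primitive_on a b f' f" "AE x in lebesgue_on {a..b}. f' x = g x"
    "g absolutely_integrable_on {a..b}"
  shows "primitive_on a b g f"
proof (rule primitive_onI[OF assms(3)])
  fix s assume s: "s \<in> {a..b}"
  show "f s = f a + integral {a..s} g"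
    using primitive_onD(2)[OF assms(1) s] integral_AE_cong_subinterval[OF assms(2), of s] s by simp
qed

definition energy :: "('a::euclidean_space \<Rightarrow> real) \<Rightarrow> (real \<Rightarrow> 'a) \<Rightarrow> real" where
  "energy W q = (LINT s|lebesgue_on {0..1}. (norm (weak_deriv q s))\<^sup>2 * W (q s))"

definition loops_in :: "'a::euclidean_space set \<Rightarrow> (real \<Rightarrow> 'a) set" where
  "loops_in S = {q \<in> H1. q 0 = q 1 \<and> (\<forall>s\<in>{0..1}. q s \<in> S)}"

text \<open>Here \<open>g\<close> and \<open>w\<close> stand for the weak derivatives of \<open>q\<close> and \<open>v\<close>.\<close>

definition first_variation ::
  "('a::euclidean_space \<Rightarrow> real) \<Rightarrow> ('a \<Rightarrow> 'a) \<Rightarrow> (real \<Rightarrow> 'a) \<Rightarrow> (real \<Rightarrow> 'a) \<Rightarrow> (real \<Rightarrow> 'a) \<Rightarrow> (real \<Rightarrow> 'a) \<Rightarrow> real"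
where
  "first_variation W G q g v w =
     (LINT s|lebesgue_on {0..1}. ((2 * W (q s)) *\<^sub>R g s) \<bullet> w s + ((norm (g s))\<^sup>2 *\<^sub>R G (q s)) \<bullet> v s)"

lemma energy_eq:
  assumes q: "H1_deriv q g" and W: "continuous_on {0..1} (\<lambda>s. W (q s))"
  shows "energy W q = (LINT s|lebesgue_on {0..1}. (norm (g s))\<^sup>2 * W (q s))"
proof -
  have [measurable]: "(\<lambda>s. W (q s)) \<in> borel_measurable (lebesgue_on {0..1})"
    using W by (intro continuous_imp_measurable_on_sets_lebesgue) auto
  note [measurable] = H1_derivD(3)[OF q] H1_derivD(3)[OF H1_deriv_weak_deriv[OF H1_deriv_imp_H1[OF q]]]
  show ?thesis
    unfolding energy_def using weak_deriv_AE_eq[OF q]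
    by (intro integral_cong_AE) (measurable, auto)
qed

text \<open>The variational half needs only a positive C^1 weight on an open set; the potential
  enters later as an instance.\<close>

locale weighted_domain =
  fixes S :: "'a::euclidean_space set" and W :: "'a \<Rightarrow> real" and G :: "'a \<Rightarrow> 'a"
  assumes open_domain: "open S"
    and gderiv: "\<And>x. x \<in> S \<Longrightarrow> GDERIV W x :> G x"
    and continuous_gradient: "continuous_on S G"
    and weight_pos: "\<And>x. x \<in> S \<Longrightarrow> W x > 0"
begin

section \<open>First order expansion of the weight and of the energy\<close>

lemma has_derivative_weight: "x \<in> S \<Longrightarrow> (W has_derivative (\<lambda>y. G x \<bullet> y)) (at x)"
  using gderiv by (simp add: gderiv_def inner_commute)

lemma continuous_weight: "continuous_on S W"
  using has_derivative_weight has_derivative_continuous by (blast intro: continuous_at_imp_continuous_on)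

text \<open>A closed neighbourhood of \<open>K\<close> is still a compact subset of
  \<open>S\<close>, so \<open>G\<close> is uniformly continuous there, and the mean value inequality
  on balls turns this into an error bound uniform in \<open>x\<close>. Uniformity is what allows
  integration along a loop.\<close>

lemma uniform_linearization:
  assumes K: "compact K" "K \<subseteq> S" and e: "e > 0"
  obtains d where "d > 0"
    "\<And>x y. x \<in> K \<Longrightarrow> norm y < d \<Longrightarrow> x + y \<in> S \<and> \<bar>W (x + y) - W x - G x \<bullet> y\<bar> \<le> e * norm y"
proof -
  obtain r where r: "r > 0" "(\<Union>x\<in>K. cball x r) \<subseteq> S"
    using compact_subset_open_imp_cball_epsilon_subset[OF K(1) open_domain K(2)] by metis
  have "uniformly_continuous_on (\<Union>x\<in>K. cball x r) G"
    using r continuous_gradient K compact_minkowski_sum_cball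
    by (intro compact_uniformly_continuous) (auto intro: continuous_on_subset)
  then obtain d where d: "d > 0"
    "\<And>x y. x \<in> (\<Union>x\<in>K. cball x r) \<Longrightarrow> y \<in> (\<Union>x\<in>K. cball x r) \<Longrightarrow> dist y x < d \<Longrightarrow> dist (G y) (G x) < e"
    unfolding uniformly_continuous_on_def using e by metis
  show thesis
  proof (rule that[of "min d r"])
    show "min d r > 0" using d(1) r(1) by simp
    fix x y :: 'a assume x: "x \<in> K" and y: "norm y < min d r"
    have near: "z \<in> S" "norm (G z - G x) \<le> e" if "z \<in> ball x (min d r)" for z
    proof -
      have "z \<in> (\<Union>x\<in>K. cball x r)" "x \<in> (\<Union>x\<in>K. cball x r)"
        using that x r(1) by (auto intro!: bexI[of _ x])
      with d(2)[of x z] that r(2) show "z \<in> S" "norm (G z - G x) \<le> e"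
        by (blast, auto simp: dist_norm norm_minus_commute)
    qed
    have "norm (W (x + y) - W x - G x \<bullet> (x + y - x)) \<le> norm (x + y - x) * e"
    proof (rule differentiable_bound_linearization[where f' = "\<lambda>z y. G z \<bullet> y" and S = "ball x (min d r)"])
      show "x + t *\<^sub>R (x + y - x) \<in> ball x (min d r)" if "t \<in> {0..1}" for t
      proof -
        have "\<bar>t\<bar> * norm y \<le> 1 * norm y" using that by (intro mult_right_mono) auto
        with y show ?thesis by (simp add: dist_norm)
      qed
      show "(W has_derivative (\<lambda>y. G z \<bullet> y)) (at z within ball x (min d r))" if "z \<in> ball x (min d r)" for z
        using has_derivative_weight[OF near(1)[OF that]] by (rule has_derivative_at_withinI)
      show "onorm ((\<lambda>i. G z \<bullet> i) - (\<lambda>i. G x \<bullet> i)) \<le> e" if "z \<in> ball x (min d r)" for z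
        unfolding fun_diff_def
      proof (rule onorm_le)
        fix i
        have "norm (G z \<bullet> i - G x \<bullet> i) \<le> norm (G z - G x) * norm i"
          using Cauchy_Schwarz_ineq2[of "G z - G x" i] by (simp add: inner_diff_left)
        also have "\<dots> \<le> e * norm i"
          using near(2)[OF that] by (intro mult_right_mono) auto
        finally show "norm (G z \<bullet> i - G x \<bullet> i) \<le> e * norm i" .
      qed
      show "x \<in> ball x (min d r)" using d(1) r(1) by simp
    qed
    moreover have "x + y \<in> S" using y by (intro near) (auto simp: dist_norm)
    ultimately show "x + y \<in> S \<and> \<bar>W (x + y) - W x - G x \<bullet> y\<bar> \<le> e * norm y"
      by (simp add: mult.commute)
  qed
qed

lemma energy_integrable:
  assumes "H1_deriv q g" "\<forall>s\<in>{0..1}. q s \<in> S"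
  shows "integrable (lebesgue_on {0..1}) (\<lambda>s. (norm (g s))\<^sup>2 * W (q s))"
proof -
  have "continuous_on {0..1} (\<lambda>s. W (q s))"
    using assms by (intro continuous_on_compose2[OF continuous_weight] H1_derivD(5)) auto
  from integrable_bounded_times[OF this H1_derivD(4)[OF assms(1)]] show ?thesis
    by (simp add: mult.commute)
qed

lemma first_variation_integrable:
  assumes q: "H1_deriv q g" "\<forall>s\<in>{0..1}. q s \<in> S"
    and w: "square_integrable_01 w" and v: "continuous_on {0..1} v"
  shows "integrable (lebesgue_on {0..1}) (\<lambda>s. ((2 * W (q s)) *\<^sub>R g s) \<bullet> w s)"
    and "integrable (lebesgue_on {0..1}) (\<lambda>s. ((norm (g s))\<^sup>2 *\<^sub>R G (q s)) \<bullet> v s)"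
proof -
  note qc = H1_derivD(5)[OF q(1)]
  show "integrable (lebesgue_on {0..1}) (\<lambda>s. ((2 * W (q s)) *\<^sub>R g s) \<bullet> w s)"
    using q H1_derivD(1)[OF q(1)] w
    by (intro integrable_inner_square_integrable square_integrable_01_times_continuous continuous_intros
        continuous_on_compose2[OF continuous_weight qc]) auto
  have "continuous_on {0..1} (\<lambda>s. G (q s) \<bullet> v s)"
    using q by (intro continuous_intros continuous_on_compose2[OF continuous_gradient qc] v) auto
  from integrable_bounded_times[OF this H1_derivD(4)[OF q(1)]]
  show "integrable (lebesgue_on {0..1}) (\<lambda>s. ((norm (g s))\<^sup>2 *\<^sub>R G (q s)) \<bullet> v s)"
    by (simp add: mult.commute)
qed

text \<open>This is Frechet differentiability together with openness of the set of loops in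
  \<open>S\<close>. Being stated for arbitrary representatives \<open>g\<close> and
  \<open>w\<close>, it serves both to compute an abstract differential and to exhibit one.\<close>

lemma energy_expansion:
  assumes q: "H1_deriv q g" "\<forall>s\<in>{0..1}. q s \<in> S" and \<epsilon>: "\<epsilon> > 0"
  shows "\<exists>\<delta>>0. \<forall>v w. H1_deriv v w \<and> H1_norm v < \<delta> \<longrightarrow>
    (\<forall>s\<in>{0..1}. q s + v s \<in> S) \<and>
    \<bar>energy W (\<lambda>s. q s + v s) - energy W q - first_variation W G q g v w\<bar> \<le> \<epsilon> * H1_norm v"
proof -
  define K where "K = q ` {0..1}"
  note qc = H1_derivD(5)[OF q(1)]
  have K: "compact K" "K \<subseteq> S"
    using qc q(2) by (auto simp: K_def intro!: compact_continuous_image)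
  have "bounded (G ` K)" "bounded (W ` K)"
    using K continuous_gradient continuous_weight
    by (auto intro!: compact_imp_bounded compact_continuous_image intro: continuous_on_subset)
  then obtain M B where M: "M > 0" "\<And>x. x \<in> K \<Longrightarrow> norm (G x) \<le> M"
    and B: "B > 0" "\<And>x. x \<in> K \<Longrightarrow> \<bar>W x\<bar> \<le> B"
    unfolding bounded_pos by (auto simp del: real_norm_def simp flip: real_norm_def)
  define g2 where "g2 = (LINT s|lebesgue_on {0..1}. (norm (g s))\<^sup>2)"
  have g2: "g2 \<ge> 0" by (simp add: g2_def)
  \<comment> \<open>The quotient makes the linear error \<open>2 * \<epsilon>1 * g2\<close> at most
    half of \<open>\<epsilon>\<close>; the cap 1 lets the bound for the increment of
    \<open>W\<close> depend on \<open>M\<close> alone.\<close>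
  define \<epsilon>1 where "\<epsilon>1 = min 1 (\<epsilon> / (4 * (g2 + 1)))"
  have \<epsilon>1: "\<epsilon>1 > 0" "\<epsilon>1 \<le> 1" using \<epsilon> g2 by (auto simp: \<epsilon>1_def)
  have "2 * (\<epsilon>1 * g2) \<le> 2 * (\<epsilon> / (4 * (g2 + 1)) * (g2 + 1))"
    using g2 \<epsilon> by (intro mult_left_mono mult_mono) (auto simp: \<epsilon>1_def)
  also have "\<dots> = \<epsilon> / 2" using g2 by (simp add: field_simps)
  finally have \<epsilon>1g: "2 * \<epsilon>1 * g2 \<le> \<epsilon> / 2" by simp
  \<comment> \<open>\<open>C\<close> collects the coefficients of the terms quadratic in the norm of
    \<open>v\<close>.\<close>
  define C where "C = (M + 1) * (4 * g2 + 1) + B + 2 * (M + 1)"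
  have C: "C > 0" using M B g2 by (auto simp: C_def intro!: add_pos_nonneg add_nonneg_pos)
  obtain d where d: "d > 0" "\<And>x y. x \<in> K \<Longrightarrow> norm y < d \<Longrightarrow> x + y \<in> S \<and> \<bar>W (x + y) - W x - G x \<bullet> y\<bar> \<le> \<epsilon>1 * norm y"
    using uniform_linearization[OF K \<epsilon>1(1)] by metis
  \<comment> \<open>\<open>d / 2\<close> pays for the factor 2 of the sup bound, 1 keeps
    \<open>W\<close> bounded near the loop, and the last entry makes the quadratic terms at most
    half of the allowed error.\<close>
  define \<delta> where "\<delta> = min (min 1 (d / 2)) (\<epsilon> / (2 * C))"
  have \<delta>: "\<delta> > 0" using d \<epsilon> C by (auto simp: \<delta>_def)
  have inS: "q s + v s \<in> S" if "H1_deriv v w" "H1_norm v < \<delta>" "s \<in> {0..1}" for v w s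
    using d(2)[of "q s" "v s"] norm_le_H1_norm[OF that(1,3)] that by (auto simp: \<delta>_def K_def)
  have est: "\<bar>energy W (\<lambda>s. q s + v s) - energy W q - first_variation W G q g v w\<bar> \<le> \<epsilon> * H1_norm v"
    if v: "H1_deriv v w" and small: "H1_norm v < \<delta>" for v w
  proof -
    define N where "N = H1_norm v"
    have N: "N \<ge> 0" "N < 1" "2 * N < d" "N \<le> \<epsilon> / (2 * C)" using small by (auto simp: N_def \<delta>_def)
    note qv = H1_deriv_add[OF q(1) v]
    have qvS: "\<forall>s\<in>{0..1}. q s + v s \<in> S" using inS[OF v small] by blast
    define R where "R \<equiv> \<lambda>s. (norm (g s + w s))\<^sup>2 * W (q s + v s) - (norm (g s))\<^sup>2 * W (q s)
      - (((2 * W (q s)) *\<^sub>R g s) \<bullet> w s + ((norm (g s))\<^sup>2 *\<^sub>R G (q s)) \<bullet> v s)"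
    define b where "b \<equiv> \<lambda>s. (2 * \<epsilon>1 * N + (M + 1) * 4 * N\<^sup>2) * (norm (g s))\<^sup>2 + ((M + 1) + (B + 2 * (M + 1))) * (norm (w s))\<^sup>2"
    note int = energy_integrable[OF qv qvS] energy_integrable[OF q]
      first_variation_integrable[OF q H1_derivD(1)[OF v] H1_derivD(5)[OF v]]
    note ints = int(1,2) Bochner_Integration.integrable_add[OF int(3,4)]
    have R: "integrable (lebesgue_on {0..1}) R"
      unfolding R_def using ints by (intro Bochner_Integration.integrable_diff)
    have cW: "continuous_on {0..1} (\<lambda>s. W (u s))" if "continuous_on {0..1} u" "\<forall>s\<in>{0..1}. u s \<in> S" for u
      using that by (intro continuous_on_compose2[OF continuous_weight that(1)]) auto
    have "energy W (\<lambda>s. q s + v s) - energy W q - first_variation W G q g v w = (LINT s|lebesgue_on {0..1}. R s)"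
      unfolding R_def energy_eq[OF qv cW[OF H1_derivD(5)[OF qv] qvS]] energy_eq[OF q(1) cW[OF qc q(2)]] first_variation_def
      using ints by simp
    also have "\<bar>\<dots>\<bar> \<le> (LINT s|lebesgue_on {0..1}. norm (R s))"
      using integral_norm_bound[of "lebesgue_on {0..1}" R] by simp
    also have "\<dots> \<le> (LINT s|lebesgue_on {0..1}. b s)"
    proof (rule integral_mono)
      show "integrable (lebesgue_on {0..1}) (\<lambda>s. norm (R s))" using R by simp
      show "integrable (lebesgue_on {0..1}) b"
        unfolding b_def using H1_derivD(4)[OF v] H1_derivD(4)[OF q(1)] by simp
      fix s :: real assume "s \<in> space (lebesgue_on {0..1})"
      then have s: "s \<in> {0..1}" by simp
      have vN: "norm (v s) \<le> 2 * N" using norm_le_H1_norm[OF v s] by (simp add: N_def)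
      have qK: "q s \<in> K" using s by (simp add: K_def)
      define a0 a1 where "a0 = W (q s + v s) - W (q s) - G (q s) \<bullet> v s" and "a1 = W (q s + v s) - W (q s)"
      have a0: "\<bar>a0\<bar> \<le> \<epsilon>1 * (2 * N)"
      proof -
        have "\<bar>a0\<bar> \<le> \<epsilon>1 * norm (v s)" using d(2)[OF qK, of "v s"] vN N by (simp add: a0_def)
        also have "\<dots> \<le> \<epsilon>1 * (2 * N)" using vN \<epsilon>1(1) by (intro mult_left_mono) auto
        finally show ?thesis .
      qed
      have "\<bar>G (q s) \<bullet> v s\<bar> \<le> M * (2 * N)"
        using M(2)[OF qK] vN M(1)
        by (intro order_trans[OF Cauchy_Schwarz_ineq2] mult_mono) auto
      moreover have "\<epsilon>1 * (2 * N) \<le> 1 * (2 * N)" using \<epsilon>1 N by (intro mult_right_mono) auto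
      ultimately have a1: "\<bar>a1\<bar> \<le> (M + 1) * (2 * N)"
        using a0 unfolding a0_def a1_def by (simp add: algebra_simps)
      have "(M + 1) * (2 * N) \<le> (M + 1) * 2" using M N by (intro mult_left_mono) auto
      then have a2: "\<bar>W (q s + v s)\<bar> \<le> B + 2 * (M + 1)"
        using a1 B(2)[OF qK] unfolding a1_def by linarith
      \<comment> \<open>Exact identity: \<open>a0\<close> is the linearization error of
        \<open>W\<close> and multiplies the term without \<open>w\<close>; the plain increment
        \<open>a1\<close> suffices next to one factor \<open>w\<close>, and boundedness of
        \<open>W\<close> next to two.\<close>
      have "R s = (norm (g s))\<^sup>2 * a0 + 2 * (g s \<bullet> w s) * a1 + (norm (w s))\<^sup>2 * W (q s + v s)"
        unfolding R_def a0_def a1_def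
        by (simp add: power2_norm_eq_inner inner_add_left inner_add_right inner_commute algebra_simps)
      then have "norm (R s) \<le> (norm (g s))\<^sup>2 * \<bar>a0\<bar> + 2 * \<bar>g s \<bullet> w s\<bar> * \<bar>a1\<bar> + (norm (w s))\<^sup>2 * \<bar>W (q s + v s)\<bar>"
        by (auto simp: abs_mult intro!: order_trans[OF abs_triangle_ineq] add_mono)
      also have "\<dots> \<le> (norm (g s))\<^sup>2 * (\<epsilon>1 * (2 * N)) + 2 * (norm (g s) * norm (w s)) * ((M + 1) * (2 * N)) + (norm (w s))\<^sup>2 * (B + 2 * (M + 1))"
        using a0 a1 a2 M(1) N Cauchy_Schwarz_ineq2[of "g s" "w s"]
        by (intro add_mono mult_mono mult_nonneg_nonneg) auto
      \<comment> \<open>Weighted AM-GM: the mixed term becomes quadratic in \<open>N\<close> without the Cauchy-Schwarz inequality in \<open>L\<^sup>2\<close>.\<close>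
      also have "2 * (norm (g s) * norm (w s)) * ((M + 1) * (2 * N)) = (M + 1) * (2 * (2 * N * norm (g s)) * norm (w s))"
        by simp
      also have "\<dots> \<le> (M + 1) * ((2 * N * norm (g s))\<^sup>2 + (norm (w s))\<^sup>2)"
        using sum_squares_bound[of "2 * N * norm (g s)" "norm (w s)"] M(1) by (intro mult_left_mono) auto
      finally show "norm (R s) \<le> b s"
        by (simp add: b_def algebra_simps power_mult_distrib)
    qed
    also have "\<dots> = (2 * \<epsilon>1 * N + (M + 1) * 4 * N\<^sup>2) * g2 + ((M + 1) + (B + 2 * (M + 1))) * (LINT s|lebesgue_on {0..1}. (norm (w s))\<^sup>2)"
      unfolding b_def g2_def using H1_derivD(4)[OF v] H1_derivD(4)[OF q(1)] by simp
    also have "\<dots> \<le> (2 * \<epsilon>1 * N + (M + 1) * 4 * N\<^sup>2) * g2 + ((M + 1) + (B + 2 * (M + 1))) * N\<^sup>2"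
      using LINT_norm_square_le_H1_norm(1)[OF v] M B by (intro add_left_mono mult_left_mono) (auto simp: N_def)
    also have "\<dots> = N * (2 * \<epsilon>1 * g2 + N * C)"
      by (simp add: C_def power2_eq_square algebra_simps)
    also have "\<dots> \<le> N * (\<epsilon> / 2 + \<epsilon> / (2 * C) * C)"
      using N C \<epsilon>1g by (intro mult_left_mono add_mono mult_right_mono) auto
    also have "\<dots> = \<epsilon> * H1_norm v" using C by (simp add: N_def)
    finally show ?thesis .
  qed
  show ?thesis
    using \<delta> inS est by blast
qed

section \<open>Vanishing first variation and the Euler-Lagrange equation\<close>

lemma first_variation_scaleR:
  "first_variation W G q g (\<lambda>s. a *\<^sub>R v s) (\<lambda>s. a *\<^sub>R w s) = a * first_variation W G q g v w"
  unfolding first_variation_def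
  by (subst integral_mult_right_zero[symmetric]) (simp add: algebra_simps)

text \<open>Along \<open>a *\<^sub>R v\<close> with small \<open>a > 0\<close>, the abstract
  expansion with \<open>L = 0\<close> and the explicit one differ by the first variation, which is
  homogeneous in \<open>a\<close>; dividing by \<open>a\<close> leaves an arbitrarily small
  bound.\<close>

lemma first_variation_eq_0:
  assumes diff: "has_H1_differential (energy W) L (loops_in S) q" and L: "\<And>v. v \<in> H1_loops \<Longrightarrow> L v = 0"
    and q: "q \<in> loops_in S" "H1_deriv q g" and v: "v \<in> H1_loops" "H1_deriv v w"
  shows "first_variation W G q g v w = 0"
proof -
  define N where "N = H1_norm v"
  have N: "N \<ge> 0" by (simp add: N_def)
  have "\<bar>first_variation W G q g v w\<bar> \<le> 0"
  proof (rule field_le_epsilon)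
    fix e :: real assume e: "e > 0"
    \<comment> \<open>The 2 accounts for the errors of the two expansions; \<open>N + 1\<close>
      replaces \<open>N\<close>, which may be 0.\<close>
    define \<epsilon> where "\<epsilon> = e / (2 * (N + 1))"
    have \<epsilon>: "\<epsilon> > 0" using e N by (simp add: \<epsilon>_def)
    obtain \<delta>1 where \<delta>1: "\<delta>1 > 0" "\<And>v. v \<in> H1_loops \<Longrightarrow> H1_norm v < \<delta>1 \<Longrightarrow> (\<lambda>s. q s + v s) \<in> loops_in S \<Longrightarrow>
        \<bar>energy W (\<lambda>s. q s + v s) - energy W q - L v\<bar> \<le> \<epsilon> * H1_norm v"
      using diff \<epsilon> unfolding has_H1_differential_def by meson
    have qS: "\<forall>s\<in>{0..1}. q s \<in> S" using q(1) by (simp add: loops_in_def)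
    obtain \<delta>2 where \<delta>2: "\<delta>2 > 0"
      "\<And>v w s. H1_deriv v w \<Longrightarrow> H1_norm v < \<delta>2 \<Longrightarrow> s \<in> {0..1} \<Longrightarrow> q s + v s \<in> S"
      "\<And>v w. H1_deriv v w \<Longrightarrow> H1_norm v < \<delta>2 \<Longrightarrow>
         \<bar>energy W (\<lambda>s. q s + v s) - energy W q - first_variation W G q g v w\<bar> \<le> \<epsilon> * H1_norm v"
      using energy_expansion[OF q(2) qS \<epsilon>] by blast
    define a where "a = min \<delta>1 \<delta>2 / (N + 1)"
    have a: "a > 0" using \<delta>1 \<delta>2 N by (simp add: a_def)
    note av = H1_deriv_scaleR[OF v(2), of a]
    have "a * N < a * (N + 1)" using a by simp
    also have "\<dots> = min \<delta>1 \<delta>2" using N by (simp add: a_def)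
    finally have aN: "H1_norm (\<lambda>s. a *\<^sub>R v s) < \<delta>1" "H1_norm (\<lambda>s. a *\<^sub>R v s) < \<delta>2"
      using H1_norm_scaleR[OF v(2), of a] a by (auto simp: N_def)
    have avl: "(\<lambda>s. a *\<^sub>R v s) \<in> H1_loops"
      using H1_deriv_imp_H1[OF av] v(1) by (simp add: H1_loops_def)
    have "(\<lambda>s. q s + a *\<^sub>R v s) \<in> loops_in S"
      using H1_deriv_imp_H1[OF H1_deriv_add[OF q(2) av]] q(1) v(1) \<delta>2(2)[OF av aN(2)]
      by (simp add: loops_in_def H1_loops_def)
    from \<delta>1(2)[OF avl aN(1) this] \<delta>2(3)[OF av aN(2)] L[OF avl]
    have "\<bar>a * first_variation W G q g v w\<bar> \<le> 2 * (\<epsilon> * (a * N))"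
      using H1_norm_scaleR[OF v(2), of a] a first_variation_scaleR[of q g a v w] by (simp add: N_def)
    also have "\<dots> = a * (2 * \<epsilon> * N)" by simp
    finally have "\<bar>first_variation W G q g v w\<bar> \<le> 2 * \<epsilon> * N"
      using a by (simp add: abs_mult)
    also have "\<dots> \<le> 2 * \<epsilon> * (N + 1)" using \<epsilon> by simp
    also have "\<dots> = e" using N by (simp add: \<epsilon>_def add_nonneg_eq_0_iff divide_simps)
    finally show "\<bar>first_variation W G q g v w\<bar> \<le> 0 + e" by simp
  qed
  then show ?thesis by simp
qed

text \<open>At a critical point the differential is the zero functional, whose linearity and
  boundedness are immediate; the remainder estimate is \<open>energy_expansion\<close>.\<close>

lemma has_H1_differential_zero:
  assumes q: "q \<in> loops_in S" "H1_deriv q g"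
    and EL: "\<And>v w. v \<in> H1_loops \<Longrightarrow> H1_deriv v w \<Longrightarrow> first_variation W G q g v w = 0"
  shows "has_H1_differential (energy W) (\<lambda>_. 0) (loops_in S) q"
  unfolding has_H1_differential_def
proof (intro conjI allI impI ballI)
  show "\<exists>K. \<forall>v\<in>H1_loops. \<bar>0\<bar> \<le> K * H1_norm (v :: real \<Rightarrow> 'a)"
    by (rule exI[of _ 0]) simp
  fix \<epsilon> :: real assume \<epsilon>: "\<epsilon> > 0"
  have qS: "\<forall>s\<in>{0..1}. q s \<in> S" using q(1) by (simp add: loops_in_def)
  obtain \<delta> where \<delta>: "\<delta> > 0"
    "\<And>v w s. H1_deriv v w \<Longrightarrow> H1_norm v < \<delta> \<Longrightarrow> s \<in> {0..1} \<Longrightarrow> q s + v s \<in> S"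
    "\<And>v w. H1_deriv v w \<Longrightarrow> H1_norm v < \<delta> \<Longrightarrow>
       \<bar>energy W (\<lambda>s. q s + v s) - energy W q - first_variation W G q g v w\<bar> \<le> \<epsilon> * H1_norm v"
    using energy_expansion[OF q(2) qS \<epsilon>] by blast
  show "\<exists>\<delta>>0. \<forall>v\<in>H1_loops. H1_norm v < \<delta> \<and> (\<lambda>s. q s + v s) \<in> loops_in S \<longrightarrow>
      \<bar>energy W (\<lambda>s. q s + v s) - energy W q - 0\<bar> \<le> \<epsilon> * H1_norm v"
  proof (intro exI[of _ \<delta>] conjI ballI impI \<delta>(1))
    fix v :: "real \<Rightarrow> 'a" assume v: "v \<in> H1_loops" "H1_norm v < \<delta> \<and> (\<lambda>s. q s + v s) \<in> loops_in S"
    then have "H1_deriv v (weak_deriv v)" by (intro H1_deriv_weak_deriv) (simp add: H1_loops_def)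
    with \<delta>(3)[OF this] EL[OF v(1) this] v show "\<bar>energy W (\<lambda>s. q s + v s) - energy W q - 0\<bar> \<le> \<epsilon> * H1_norm v"
      by simp
  qed
qed simp_all

lemma first_variation_eq_integral:
  assumes q: "H1_deriv q g" "\<forall>s\<in>{0..1}. q s \<in> S"
    and w: "square_integrable_01 w" and v: "continuous_on {0..1} v"
  shows "first_variation W G q g v w =
    integral {0..1} (\<lambda>s. ((2 * W (q s)) *\<^sub>R g s) \<bullet> w s) + integral {0..1} (\<lambda>s. ((norm (g s))\<^sup>2 *\<^sub>R G (q s)) \<bullet> v s)"
  unfolding first_variation_def using first_variation_integrable[OF assms]
  by (simp add: lebesgue_integral_eq_integral)

text \<open>Integration by parts leaves only the boundary term of
  \<open>2 W(q) p \<bullet> v\<close>, and it cancels because \<open>q\<close>, \<open>p\<close> and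
  \<open>v\<close> all take equal values at 0 and 1.\<close>

lemma first_variation_eq_0_of_euler_lagrange:
  assumes q: "H1_deriv q p" "\<forall>s\<in>{0..1}. q s \<in> S" and p: "continuous_on {0..1} p"
    and EL: "\<And>s. s \<in> {0..1} \<Longrightarrow>
      ((\<lambda>s. (2 * W (q s)) *\<^sub>R p s) has_vector_derivative (norm (p s))\<^sup>2 *\<^sub>R G (q s)) (at s within {0..1})"
    and per: "q 0 = q 1" "p 0 = p 1"
    and v: "v \<in> H1_loops" "H1_deriv v w"
  shows "first_variation W G q p v w = 0"
proof -
  have "primitive_on 0 1 (\<lambda>s. (norm (p s))\<^sup>2 *\<^sub>R G (q s)) (\<lambda>s. (2 * W (q s)) *\<^sub>R p s)"
    using q(2) by (intro primitive_on_of_has_vector_derivative EL continuous_intros p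
        continuous_on_compose2[OF continuous_gradient H1_derivD(5)[OF q(1)]]) auto
  from primitive_on_bounded_bilinear(3)[OF bounded_bilinear_inner _ this H1_derivD(2)[OF v(2)]]
  show ?thesis
    using v(1) per unfolding first_variation_eq_integral[OF q H1_derivD(1)[OF v(2)] H1_derivD(5)[OF v(2)]]
    by (simp add: H1_loops_def)
qed

text \<open>With \<open>f = 2 W(q) g\<close>, \<open>k = \<bar>g\<bar>\<^sup>2 \<nabla>W(q)\<close> and a primitive \<open>K\<close> of \<open>k\<close>, constant variations give
  \<open>K 1 = K 0\<close>, and the variation with derivative \<open>f - K - c\<close>, where \<open>c\<close> is the mean of \<open>f - K\<close>, gives
  \<open>\<integral> \<bar>f - K - c\<bar>\<^sup>2 = 0\<close>.\<close>

lemma euler_lagrange: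
  assumes q: "H1_deriv q g" "\<forall>s\<in>{0..1}. q s \<in> S"
    and EL: "\<And>v w. v \<in> H1_loops \<Longrightarrow> H1_deriv v w \<Longrightarrow> first_variation W G q g v w = 0"
  shows "\<exists>p. continuous_on {0..1} p \<and> (AE s in lebesgue_on {0..1}. g s = p s) \<and> primitive_on 0 1 p q \<and>
    (\<forall>s\<in>{0..1}. ((\<lambda>s. (2 * W (q s)) *\<^sub>R p s) has_vector_derivative (norm (p s))\<^sup>2 *\<^sub>R G (q s))
      (at s within {0..1})) \<and>
    (2 * W (q 0)) *\<^sub>R p 0 = (2 * W (q 1)) *\<^sub>R p 1"
proof -
  note qc = H1_derivD(5)[OF q(1)]
  have cW: "continuous_on {0..1} (\<lambda>s. W (q s))" and cG: "continuous_on {0..1} (\<lambda>s. G (q s))"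
    using q(2) by (auto intro: continuous_on_compose2[OF continuous_weight qc] continuous_on_compose2[OF continuous_gradient qc])
  define f where "f \<equiv> \<lambda>s. (2 * W (q s)) *\<^sub>R g s"
  define k where "k \<equiv> \<lambda>s. (norm (g s))\<^sup>2 *\<^sub>R G (q s)"
  define K where "K \<equiv> \<lambda>s. integral {0..s} k"
  have f: "square_integrable_01 f"
    unfolding f_def by (intro square_integrable_01_times_continuous continuous_intros cW H1_derivD(1)[OF q(1)])
  have "(\<lambda>s. (norm (g s))\<^sup>2) absolutely_integrable_on {0..1}"
    using H1_derivD(4)[OF q(1)] by (simp add: integrable_restrict_space set_integrable_def)
  then have k: "k absolutely_integrable_on {0..1}"
    unfolding k_def by (rule absolutely_integrable_bounded_bilinear[OF bounded_bilinear.flip[OF bounded_bilinear_scaleR] cG])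
  have K: "primitive_on 0 1 k K"
    using primitive_on_indefinite_integral[OF k, of 0] by (simp add: K_def)
  note Kc = primitive_on_continuous[OF K]
  have var: "integral {0..1} (\<lambda>s. f s \<bullet> w s) + integral {0..1} (\<lambda>s. k s \<bullet> v s) = 0"
    if "v \<in> H1_loops" "H1_deriv v w" for v w
    using EL[OF that] unfolding first_variation_eq_integral[OF q H1_derivD(1)[OF that(2)] H1_derivD(5)[OF that(2)]]
    by (simp add: f_def k_def)
  have "K 1 \<bullet> i = 0" for i
  proof -
    have "H1_deriv (\<lambda>s. i) (\<lambda>s. 0)"
      unfolding H1_deriv_def by (auto intro!: square_integrable_01_continuous primitive_onI)
    moreover from H1_deriv_imp_H1[OF this] have "(\<lambda>s. i) \<in> H1_loops" by (simp add: H1_loops_def)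
    ultimately have "integral {0..1} (\<lambda>s. k s \<bullet> i) = 0" using var by fastforce
    moreover have "(k has_integral K 1) {0..1}"
      using k by (simp add: K_def absolutely_integrable_on_def integrable_integral)
    from has_integral_linear[OF this bounded_linear_inner_left[of i]]
    have "integral {0..1} (\<lambda>s. k s \<bullet> i) = K 1 \<bullet> i" by (simp add: o_def integral_unique)
    ultimately show ?thesis by simp
  qed
  from this[of "K 1"] have K1: "K 1 = 0" by simp
  have K0: "K 0 = 0" by (simp add: K_def)
  have fK: "square_integrable_01 (\<lambda>s. f s + (-1) *\<^sub>R K s)"
    by (intro square_integrable_01_add square_integrable_01_continuous continuous_intros Kc f)
  \<comment> \<open>Subtracting the mean gives \<open>e\<close> integral zero, so that its primitive
    \<open>v\<close> closes up to a loop.\<close>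
  define c where "c = integral {0..1} (\<lambda>s. f s + (-1) *\<^sub>R K s)"
  define e where "e \<equiv> \<lambda>s. (f s + (-1) *\<^sub>R K s) + (-c)"
  have e: "square_integrable_01 e"
    unfolding e_def by (intro square_integrable_01_add[OF fK] square_integrable_01_continuous continuous_intros)
  note ea = square_integrable_01_imp_absolutely_integrable[OF e]
  have e0: "integral {0..1} e = 0"
    unfolding e_def using square_integrable_01_imp_absolutely_integrable[OF fK]
    by (subst integral_add) (auto simp: c_def absolutely_integrable_on_def)
  define v where "v \<equiv> \<lambda>s. integral {0..s} e"
  have v: "primitive_on 0 1 e v"
    using primitive_on_indefinite_integral[OF ea, of 0] by (simp add: v_def)
  have ve: "H1_deriv v e" using e v by (simp add: H1_deriv_def)
  have v01: "v 0 = 0" "v 1 = 0" by (simp_all add: v_def e0)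
  have vl: "v \<in> H1_loops" using H1_deriv_imp_H1[OF ve] v01 by (simp add: H1_loops_def)
  have ie: "u absolutely_integrable_on {0..1} \<Longrightarrow> u integrable_on {0..1}" for u :: "real \<Rightarrow> real"
    by (simp add: absolutely_integrable_on_def)
  have fe: "(\<lambda>s. f s \<bullet> e s) integrable_on {0..1}"
    using integrable_inner_square_integrable[OF f e] by (intro integrable_on_lebesgue_on) auto
  note parts = primitive_on_bounded_bilinear[OF bounded_bilinear_inner _ K v, simplified v01 K1 K0]
  have ce: "((\<lambda>s. c \<bullet> e s) has_integral 0) {0..1}"
  proof -
    have "(e has_integral 0) {0..1}"
      using ea e0 by (metis absolutely_integrable_on_def integrable_integral)
    from has_integral_linear[OF this bounded_linear_inner_right[of c]] show ?thesis by (simp add: o_def)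
  qed
  \<comment> \<open>The \<open>f\<close> and \<open>K\<close> terms cancel: by criticality and by
    integration by parts, both integrals against \<open>e\<close> equal minus the integral of
    \<open>k \<bullet> v\<close>.\<close>
  have "integral {0..1} (\<lambda>s. e s \<bullet> e s) = integral {0..1} (\<lambda>s. f s \<bullet> e s - K s \<bullet> e s - c \<bullet> e s)"
    by (simp add: e_def inner_diff_left inner_add_left)
  also have "\<dots> = integral {0..1} (\<lambda>s. f s \<bullet> e s) - integral {0..1} (\<lambda>s. K s \<bullet> e s) - integral {0..1} (\<lambda>s. c \<bullet> e s)"
    using fe ie[OF parts(1)] ce
    by (simp add: Henstock_Kurzweil_Integration.integral_diff integrable_diff has_integral_integrable)
  also have "\<dots> = 0"
    using var[OF vl ve] parts(3) integral_unique[OF ce] by simp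
  finally have "(LINT s|lebesgue_on {0..1}. e s \<bullet> e s) = 0"
    using integrable_inner_square_integrable[OF e e] by (subst lebesgue_integral_eq_integral) auto
  then have "AE s in lebesgue_on {0..1}. e s \<bullet> e s = 0"
    using integrable_inner_square_integrable[OF e e]
    by (subst (asm) integral_nonneg_eq_0_iff_AE) auto
  then have ae: "AE s in lebesgue_on {0..1}. f s = K s + c"
    by eventually_elim (simp add: e_def eq_neg_iff_add_eq_0 diff_diff_eq)
  \<comment> \<open>Division by the positive weight turns the continuous function
    \<open>K + c\<close> into a continuous representative of \<open>g\<close>.\<close>
  define p where "p \<equiv> \<lambda>s. (1 / (2 * W (q s))) *\<^sub>R (K s + c)"
  have Wpos: "W (q s) > 0" if "s \<in> {0..1}" for s using weight_pos q(2) that by blast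
  have pc: "continuous_on {0..1} p"
    unfolding p_def using Wpos by (intro continuous_intros cW Kc) force
  have gp: "AE s in lebesgue_on {0..1}. g s = p s"
    using ae AE_space
  proof eventually_elim
    case (elim s)
    have "W (q s) > 0" using Wpos elim(2) by simp
    then have "(1 / (2 * W (q s))) *\<^sub>R f s = g s" by (simp add: f_def)
    then show ?case unfolding p_def elim(1)[symmetric] by simp
  qed
  have Fp: "(2 * W (q s)) *\<^sub>R p s = K s + c" if "s \<in> {0..1}" for s
    using Wpos[OF that] by (simp add: p_def)
  have pq: "primitive_on 0 1 p q"
    using primitive_on_AE_cong[OF H1_derivD(2)[OF q(1)] gp absolutely_integrable_continuous_real[OF pc]] .
  \<comment> \<open>Bootstrapping: with \<open>p\<close> for \<open>g\<close> the integrand of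
    \<open>K\<close> becomes continuous, so \<open>K\<close> is differentiable in the ordinary
    sense.\<close>
  define k' where "k' \<equiv> \<lambda>s. (norm (p s))\<^sup>2 *\<^sub>R G (q s)"
  have k'c: "continuous_on {0..1} k'" unfolding k'_def by (intro continuous_intros pc cG)
  have "primitive_on 0 1 k' K"
  proof (rule primitive_on_AE_cong[OF K _ absolutely_integrable_continuous_real[OF k'c]])
    show "AE s in lebesgue_on {0..1}. k s = k' s"
      using gp by eventually_elim (simp add: k_def k'_def)
  qed
  note dK = primitive_on_has_vector_derivative[OF this k'c]
  show ?thesis
  proof (intro exI[of _ p] conjI pc gp pq ballI)
    fix s :: real assume s: "s \<in> {0..1}"
    have "((\<lambda>s. K s + c) has_vector_derivative k' s + 0) (at s within {0..1})"
      by (intro has_vector_derivative_add has_vector_derivative_const dK s)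
    then show "((\<lambda>s. (2 * W (q s)) *\<^sub>R p s) has_vector_derivative (norm (p s))\<^sup>2 *\<^sub>R G (q s)) (at s within {0..1})"
      using has_vector_derivative_transform[OF s Fp] by (simp add: k'_def)
  next
    show "(2 * W (q 0)) *\<^sub>R p 0 = (2 * W (q 1)) *\<^sub>R p 1"
      using Fp[of 0] Fp[of 1] K0 K1 by simp
  qed
qed

end

section \<open>Change of parameter\<close>

text \<open>Covers both time changes: from the loop parameter to time, and from time back to the
  loop parameter.\<close>

locale reparametrization =
  fixes a b :: real and t \<theta> :: "real \<Rightarrow> real"
  assumes ab: "a < b"
    and deriv: "\<And>s. s \<in> {a..b} \<Longrightarrow> (t has_real_derivative \<theta> s) (at s within {a..b})"
    and speed_pos: "\<And>s. s \<in> {a..b} \<Longrightarrow> \<theta> s > 0"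
begin

abbreviation inv_param :: "real \<Rightarrow> real" where
  "inv_param \<equiv> the_inv_into {a..b} t"

lemma strictly_increasing:
  assumes "a \<le> r" "r < s" "s \<le> b"
  shows "t r < t s"
proof -
  have "\<exists>x\<in>{r<..<s}. t s - t r = \<theta> x * (s - r)"
  proof (rule mvt_simple[OF assms(2)])
    fix x assume "r \<le> x" "x \<le> s"
    with assms show "(t has_derivative (*) (\<theta> x)) (at x within {r..s})"
      using deriv[of x] unfolding has_field_derivative_def by (auto intro: has_derivative_subset)
  qed
  then obtain x where x: "x \<in> {r<..<s}" "t s - t r = \<theta> x * (s - r)" by blast
  then have "\<theta> x * (s - r) > 0" using speed_pos[of x] assms by (intro mult_pos_pos) auto
  with x show ?thesis by simp
qed

lemma continuous: "continuous_on {a..b} t"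
  unfolding continuous_on_eq_continuous_within using deriv DERIV_continuous by blast

lemma inj: "inj_on t {a..b}"
  by (rule linorder_inj_onI) (use strictly_increasing in \<open>force+\<close>)

lemma image: "t ` {a..b} = {t a..t b}"
proof (intro equalityI subsetI)
  fix y assume "y \<in> t ` {a..b}"
  then obtain s where s: "s \<in> {a..b}" "y = t s" by blast
  then show "y \<in> {t a..t b}"
    using strictly_increasing[of a s] strictly_increasing[of s b] by (cases "s = a"; cases "s = b") auto
next
  fix y assume "y \<in> {t a..t b}"
  then show "y \<in> t ` {a..b}" using IVT'[of t a y b] continuous ab by auto
qed

lemma bij: "bij_betw t {a..b} {t a..t b}"
  using inj image by (simp add: bij_betw_def)

lemma inv_param_t: "s \<in> {a..b} \<Longrightarrow> inv_param (t s) = s"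
  using inj by (simp add: the_inv_into_f_f)

lemma inv_param_in: "y \<in> {t a..t b} \<Longrightarrow> inv_param y \<in> {a..b}"
  using image inv_param_t by (metis imageE)

lemma t_inv_param: "y \<in> {t a..t b} \<Longrightarrow> t (inv_param y) = y"
  using inj image by (simp add: f_the_inv_into_f)

text \<open>At the end points the derivatives are one-sided, so the difference quotient of
  \<open>t\<close> is composed with the inverse. The inverse is continuous and injective, hence
  tends to \<open>s\<close> without taking the value \<open>s\<close>, and reciprocals can be taken
  since the speed is positive.\<close>

lemma inv_param_deriv:
  assumes y: "y \<in> {t a..t b}"
  shows "(inv_param has_real_derivative 1 / \<theta> (inv_param y)) (at y within {t a..t b})"
proof -
  define s where "s = inv_param y"
  have s: "s \<in> {a..b}" "t s = y" using inv_param_in[OF y] t_inv_param[OF y] by (auto simp: s_def)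
  have cont: "continuous_on {t a..t b} inv_param"
    using continuous_on_inv_into[OF continuous _ inj] image by simp
  have "filterlim inv_param (at s within {a..b}) (at y within {t a..t b})"
    unfolding filterlim_at
  proof
    show "\<forall>\<^sub>F z in at y within {t a..t b}. inv_param z \<in> {a..b} \<and> inv_param z \<noteq> s"
      unfolding eventually_at_filter
    proof (intro always_eventually allI impI conjI)
      fix z assume z: "z \<noteq> y" "z \<in> {t a..t b}"
      show "inv_param z \<in> {a..b}" using inv_param_in z(2) .
      show "inv_param z \<noteq> s" using t_inv_param[OF z(2)] s(2) z(1) by auto
    qed
    show "(inv_param \<longlongrightarrow> s) (at y within {t a..t b})"
      using cont y by (auto simp: s_def continuous_on_def)
  qed
  moreover have "((\<lambda>z. (t z - t s) / (z - s)) \<longlongrightarrow> \<theta> s) (at s within {a..b})"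
    using deriv[OF s(1)] by (simp add: has_field_derivative_iff)
  ultimately have "((\<lambda>z. (t (inv_param z) - t s) / (inv_param z - s)) \<longlongrightarrow> \<theta> s) (at y within {t a..t b})"
    by (rule filterlim_compose[rotated])
  then have "((\<lambda>z. inverse ((t (inv_param z) - t s) / (inv_param z - s))) \<longlongrightarrow> inverse (\<theta> s)) (at y within {t a..t b})"
    using speed_pos[OF s(1)] by (intro tendsto_inverse) auto
  then have "((\<lambda>z. (inv_param z - s) / (z - y)) \<longlongrightarrow> inverse (\<theta> s)) (at y within {t a..t b})"
  proof (rule Lim_transform_eventually)
    have "inverse ((t (inv_param z) - t s) / (inv_param z - s)) = (inv_param z - s) / (z - y)"
      if "z \<in> {t a..t b}" for z
      using t_inv_param[OF that] s(2) by (simp add: inverse_eq_divide)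
    then show "\<forall>\<^sub>F z in at y within {t a..t b}.
        inverse ((t (inv_param z) - t s) / (inv_param z - s)) = (inv_param z - s) / (z - y)"
      unfolding eventually_at_filter by (intro always_eventually) blast
  qed
  then show ?thesis
    by (simp add: has_field_derivative_iff s_def inverse_eq_divide)
qed

lemma has_vector_derivative_reparam:
  assumes y: "y \<in> {t a..t b}"
    and q: "(q has_vector_derivative p) (at (inv_param y) within {a..b})"
  shows "((\<lambda>y. q (inv_param y)) has_vector_derivative (1 / \<theta> (inv_param y)) *\<^sub>R p) (at y within {t a..t b})"
proof -
  have "(q has_vector_derivative p) (at (inv_param y) within inv_param ` {t a..t b})"
    using q inv_param_in by (auto intro: has_vector_derivative_within_subset)
  from vector_diff_chain_within[OF inv_param_deriv[OF y, unfolded has_real_derivative_iff_has_vector_derivative] this]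
  show ?thesis by (simp add: o_def)
qed

end

section \<open>The relativistic equation of motion\<close>

locale relativistic_potential =
  fixes m c h :: real and \<Omega> :: "'a::euclidean_space set" and V :: "'a \<Rightarrow> real" and gradV :: "'a \<Rightarrow> 'a"
  assumes m: "m > 0" and c: "c > 0" and open_\<Omega>: "open \<Omega>"
    and gderiv_V: "\<And>x. x \<in> \<Omega> \<Longrightarrow> GDERIV V x :> gradV x"
    and continuous_gradV: "continuous_on \<Omega> gradV"
begin

abbreviation S :: "'a set" where "S \<equiv> Omega_h \<Omega> V h"
definition W :: "'a \<Rightarrow> real" where "W x = Z_h m c V h x + 2 * h * m"
definition U :: "'a \<Rightarrow> real" where "U x = V x + h + m * c\<^sup>2"
definition G :: "'a \<Rightarrow> 'a" where "G x = (2 * U x / c\<^sup>2) *\<^sub>R gradV x"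

lemma W_eq: "c\<^sup>2 * W x = (U x)\<^sup>2 - (m * c\<^sup>2)\<^sup>2"
  using c by (simp add: W_def Z_h_def U_def power2_eq_square field_simps)

lemma U_gt: "x \<in> S \<Longrightarrow> U x > m * c\<^sup>2"
  by (simp add: Omega_h_def U_def)

lemma mc2_pos: "m * c\<^sup>2 > 0"
  using m c by simp

lemma U_pos: "x \<in> S \<Longrightarrow> U x > 0"
  using U_gt mc2_pos less_trans by blast

lemma W_pos:
  assumes "x \<in> S"
  shows "W x > 0"
proof -
  have "(m * c\<^sup>2)\<^sup>2 < (U x)\<^sup>2" using U_gt[OF assms] mc2_pos by (intro power_strict_mono) auto
  then have "0 < c\<^sup>2 * W x" unfolding W_eq by simp
  then show ?thesis using c by (simp add: zero_less_mult_iff)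
qed

lemma has_derivative_V: "x \<in> \<Omega> \<Longrightarrow> (V has_derivative (\<lambda>y. gradV x \<bullet> y)) (at x)"
  using gderiv_V by (simp add: gderiv_def inner_commute)

lemma continuous_V: "continuous_on \<Omega> V"
  using has_derivative_V has_derivative_continuous by (blast intro: continuous_at_imp_continuous_on)

lemma S_subset: "S \<subseteq> \<Omega>"
  by (auto simp: Omega_h_def)

lemma open_S: "open S"
proof -
  have "open (\<Omega> \<inter> (\<lambda>x. V x + h) -` {0<..})"
    by (intro continuous_open_preimage continuous_intros continuous_V open_\<Omega>)
  moreover have "\<Omega> \<inter> (\<lambda>x. V x + h) -` {0<..} = S" by (auto simp: Omega_h_def)
  ultimately show ?thesis by simp
qed

lemma continuous_U: "continuous_on S U"
  unfolding U_def by (intro continuous_intros continuous_on_subset[OF continuous_V S_subset])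

lemma gderiv_W:
  assumes "x \<in> S"
  shows "GDERIV W x :> G x"
proof -
  have "(V has_derivative (\<lambda>y. gradV x \<bullet> y)) (at x)"
    using has_derivative_V assms S_subset by blast
  then have "((\<lambda>x. 2 * m * V x + k * (V x + h)\<^sup>2 + 2 * h * m) has_derivative
      (\<lambda>y. 2 * m * (gradV x \<bullet> y) + k * (2 * (V x + h) * (gradV x \<bullet> y)))) (at x)" for k
    by (auto intro!: derivative_eq_intros simp: algebra_simps)
  from this[of "1 / c\<^sup>2"]
  have "(W has_derivative (\<lambda>y. 2 * m * (gradV x \<bullet> y) + 1 / c\<^sup>2 * (2 * (V x + h) * (gradV x \<bullet> y)))) (at x)"
    unfolding W_def Z_h_def .
  moreover have "2 * m * z + 1 / c\<^sup>2 * (2 * (V x + h) * z) = 2 * U x / c\<^sup>2 * z" for z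
    using c by (simp add: U_def field_simps)
  ultimately show ?thesis
    by (simp add: gderiv_def G_def inner_commute)
qed

sublocale weighted_domain S W G
proof
  show "continuous_on S G"
    unfolding G_def using c
    by (intro continuous_intros continuous_U continuous_on_subset[OF continuous_gradV S_subset]) auto
qed (auto intro: open_S gderiv_W W_pos)

lemma energy_h_eq: "energy_h m c V h = energy W"
  by (simp add: fun_eq_iff energy_h_def energy_def W_def)

lemma Lambda_h_eq: "Lambda_h \<Omega> V h = loops_in S"
  by (simp add: Lambda_h_def loops_in_def)

section \<open>Speed and Lorentz factor on the energy level\<close>

lemma lorentz_factor:
  assumes "x \<in> S" "n \<ge> 0" "n\<^sup>2 = c ^ 4 * W x / (U x)\<^sup>2"
  shows "n < c" "sqrt (1 - n\<^sup>2 / c\<^sup>2) = m * c\<^sup>2 / U x"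
proof -
  have U: "U x > 0" using U_pos assms(1) by blast
  have "n\<^sup>2 / c\<^sup>2 = (c\<^sup>2 * W x) / (U x)\<^sup>2"
    using c unfolding assms(3) by (simp add: power2_eq_square power4_eq_xxxx)
  \<comment> \<open>By \<open>W_eq\<close> the radicand is a nonzero perfect square; its positivity
    also yields the strict bound \<open>n < c\<close>.\<close>
  then have eq: "1 - n\<^sup>2 / c\<^sup>2 = (m * c\<^sup>2 / U x)\<^sup>2"
    unfolding W_eq using U by (simp add: field_simps power_divide)
  then show "sqrt (1 - n\<^sup>2 / c\<^sup>2) = m * c\<^sup>2 / U x"
    using mc2_pos U m c by (simp add: real_sqrt_unique)
  have "0 < (m * c\<^sup>2 / U x)\<^sup>2" using mc2_pos U m c by simp
  then have "n\<^sup>2 / c\<^sup>2 < 1" using eq by linarith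
  then have "n\<^sup>2 < c\<^sup>2" using c by simp
  then show "n < c" using c by (simp add: power_less_imp_less_base)
qed

text \<open>Converse of \<open>lorentz_factor\<close>: \<open>n < c\<close> keeps the radicand
  positive, so the energy relation can be inverted and squared.\<close>

lemma speed_of_energy:
  assumes "x \<in> S" "n \<ge> 0" "n < c" "m * c\<^sup>2 / sqrt (1 - n\<^sup>2 / c\<^sup>2) = U x"
  shows "n\<^sup>2 = c ^ 4 * W x / (U x)\<^sup>2"
proof -
  have U: "U x > 0" using U_pos assms(1) by blast
  have "n\<^sup>2 < c\<^sup>2" using assms by (intro power_strict_mono) auto
  then have pos: "1 - n\<^sup>2 / c\<^sup>2 > 0" using c by simp
  define r where "r = sqrt (1 - n\<^sup>2 / c\<^sup>2)"
  have "r > 0" "m * c\<^sup>2 / r = U x" using pos assms(4) by (auto simp: r_def)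
  then have "sqrt (1 - n\<^sup>2 / c\<^sup>2) = m * c\<^sup>2 / U x"
    using U unfolding r_def[symmetric] by (auto simp: field_simps)
  then have "(sqrt (1 - n\<^sup>2 / c\<^sup>2))\<^sup>2 = (m * c\<^sup>2 / U x)\<^sup>2" by simp
  then have "1 - n\<^sup>2 / c\<^sup>2 = (m * c\<^sup>2)\<^sup>2 / (U x)\<^sup>2" using pos by (simp add: power_divide)
  then have "n\<^sup>2 * (U x)\<^sup>2 = c\<^sup>2 * ((U x)\<^sup>2 - (m * c\<^sup>2)\<^sup>2)"
    using U c by (simp add: field_simps)
  then show ?thesis
    using U unfolding W_eq[symmetric] by (simp add: field_simps power4_eq_xxxx power2_eq_square)
qed

text \<open>The Lagrangian \<open>W(q) |p|^2\<close> does not depend on the parameter. With momentum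
  \<open>F = 2 W(q) p\<close> its Hamiltonian is \<open>(F \<bullet> F) / (4 * W(q))\<close>, which
  is conserved and equals the density.\<close>

lemma energy_density_constant:
  assumes qS: "\<forall>s\<in>{0..1}. q s \<in> S"
    and q: "\<And>s. s \<in> {0..1} \<Longrightarrow> (q has_vector_derivative p s) (at s within {0..1})"
    and EL: "\<And>s. s \<in> {0..1} \<Longrightarrow>
      ((\<lambda>s. (2 * W (q s)) *\<^sub>R p s) has_vector_derivative (norm (p s))\<^sup>2 *\<^sub>R G (q s)) (at s within {0..1})"
  shows "\<exists>E. \<forall>s\<in>{0..1}. W (q s) * (norm (p s))\<^sup>2 = E"
proof -
  define F where "F \<equiv> \<lambda>s. (2 * W (q s)) *\<^sub>R p s"
  \<comment> \<open>Only \<open>F\<close>, not \<open>p\<close> itself, is known to be differentiable by hypothesis.\<close>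
  have "\<exists>E. \<forall>s\<in>{0..1}. (F s \<bullet> F s) / (4 * W (q s)) = E"
  proof (rule has_field_derivative_zero_constant)
    fix s :: real assume s: "s \<in> {0..1}"
    have Wp: "W (q s) > 0" using W_pos qS s by blast
    have dF: "(F has_vector_derivative (norm (p s))\<^sup>2 *\<^sub>R G (q s)) (at s within {0..1})"
      unfolding F_def by (rule EL[OF s])
    have dW: "((\<lambda>s. W (q s)) has_real_derivative G (q s) \<bullet> p s) (at s within {0..1})"
      using vector_derivative_diff_chain_within[OF q[OF s] has_derivative_at_withinI[OF has_derivative_weight]] qS s
      by (auto simp: has_real_derivative_iff_has_vector_derivative o_def)
    have dFF: "((\<lambda>s. F s \<bullet> F s) has_real_derivative 2 * (F s \<bullet> ((norm (p s))\<^sup>2 *\<^sub>R G (q s)))) (at s within {0..1})"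
      using bounded_bilinear.has_vector_derivative[OF bounded_bilinear_inner dF dF]
      by (simp add: has_real_derivative_iff_has_vector_derivative inner_commute)
    have "((\<lambda>s. (F s \<bullet> F s) / (4 * W (q s))) has_real_derivative
      (2 * (F s \<bullet> ((norm (p s))\<^sup>2 *\<^sub>R G (q s))) * (4 * W (q s)) - (F s \<bullet> F s) * (4 * (G (q s) \<bullet> p s))) / ((4 * W (q s)) * (4 * W (q s)))) (at s within {0..1})"
      using Wp by (intro DERIV_divide dFF DERIV_cmult dW) auto
    also have "2 * (F s \<bullet> ((norm (p s))\<^sup>2 *\<^sub>R G (q s))) * (4 * W (q s)) - (F s \<bullet> F s) * (4 * (G (q s) \<bullet> p s)) = 0"
      by (simp add: F_def power2_norm_eq_inner inner_commute algebra_simps)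
    finally show "((\<lambda>s. (F s \<bullet> F s) / (4 * W (q s))) has_real_derivative 0) (at s within {0..1})" by simp
  qed auto
  moreover have "(F s \<bullet> F s) / (4 * W (q s)) = W (q s) * (norm (p s))\<^sup>2" if "s \<in> {0..1}" for s
  proof -
    have "W (q s) > 0" using W_pos qS that by blast
    then show ?thesis by (simp add: F_def power2_norm_eq_inner field_simps)
  qed
  ultimately show ?thesis by simp
qed

section \<open>From critical points to periodic solutions\<close>

lemma velocity_eq:
  assumes "0 < T" "y \<in> {0..T}" "(x has_vector_derivative x') (at y within {0..T})"
  shows "velocity T x y = x'"
  unfolding velocity_def using assms by (intro vector_derivative_within_closed_interval)

lemma solution_of_critical_point:
  assumes crit: "critical_point m c \<Omega> V h q" and nonconst: "\<not> q constant_on {0..1}"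
  defines "t \<equiv> time_of m c V h q"
  defines "T \<equiv> t 1"
  defines "x \<equiv> \<lambda>y. q (the_inv_into {0..1} t y)"
  shows "bij_betw t {0..1} {0..T}"
    and "\<forall>y\<in>{0..T}. x y \<in> S \<and> norm (velocity T x y) < c"
    and "periodic_solution m c \<Omega> gradV T x"
    and "energy_conservation m c V h T x"
proof -
  define g where "g = weak_deriv q"
  obtain L where L: "has_H1_differential (energy W) L (loops_in S) q" "\<And>v. v \<in> H1_loops \<Longrightarrow> L v = 0"
    and ql: "q \<in> loops_in S"
    using crit unfolding critical_point_def energy_h_eq Lambda_h_eq by blast
  have qS: "\<forall>s\<in>{0..1}. q s \<in> S" and q01: "q 0 = q 1" and qg: "H1_deriv q g"
    using ql by (auto simp: loops_in_def g_def H1_deriv_weak_deriv)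
  note qc = H1_derivD(5)[OF qg]
  obtain p where p: "continuous_on {0..1} p" "AE s in lebesgue_on {0..1}. g s = p s" "primitive_on 0 1 p q"
    and EL: "\<And>s. s \<in> {0..1} \<Longrightarrow>
      ((\<lambda>s. (2 * W (q s)) *\<^sub>R p s) has_vector_derivative (norm (p s))\<^sup>2 *\<^sub>R G (q s)) (at s within {0..1})"
    and F01: "(2 * W (q 0)) *\<^sub>R p 0 = (2 * W (q 1)) *\<^sub>R p 1"
    using euler_lagrange[OF qg qS first_variation_eq_0[OF L ql qg]] by blast
  have Wp: "W (q s) > 0" and Up: "U (q s) > 0" if "s \<in> {0..1}" for s
    using W_pos U_pos qS that by blast+
  have p01: "p 0 = p 1" using F01 q01 Wp[of 1] by simp
  note dq = primitive_on_has_vector_derivative[OF p(3,1)]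
  obtain E where E: "\<And>s. s \<in> {0..1} \<Longrightarrow> W (q s) * (norm (p s))\<^sup>2 = E"
    using energy_density_constant[OF qS dq EL] by blast
  have "E \<noteq> 0"
  proof
    assume "E = 0"
    then have p0: "p s = 0" if "s \<in> {0..1}" for s using E[OF that] Wp[OF that] by simp
    have "q s = q 0" if s: "s \<in> {0..1}" for s
    proof -
      have "integral {0..s} p = 0"
        using p0 s by (intro integral_unique has_integral_is_0) auto
      then show ?thesis using primitive_onD(2)[OF p(3) s] by (metis add.right_neutral)
    qed
    with nonconst show False unfolding constant_on_def by blast
  qed
  moreover have "0 \<le> W (q 0) * (norm (p 0))\<^sup>2" using Wp[of 0] by simp
  with E[of 0] have "E \<ge> 0" by simp
  ultimately have Epos: "E > 0" by simp
  have ppos: "norm (p s) > 0" if "s \<in> {0..1}" for s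
    using E[OF that] Epos by (cases "p s = 0") auto
  have sqE: "sqrt E = sqrt (W (q s)) * norm (p s)" if "s \<in> {0..1}" for s
    unfolding E[OF that, symmetric] by (simp add: real_sqrt_mult)
  \<comment> \<open>The continuous factor of the integrand of \<open>time_of\<close>. The other
    factor is only integrable until \<open>p\<close> replaces \<open>weak_deriv q\<close>, which
    leaves the integral unchanged and makes \<open>t\<close> continuously differentiable.\<close>
  define u where "u \<equiv> \<lambda>s. U (q s) / sqrt (W (q s)) * (1 / c\<^sup>2)"
  have cu: "continuous_on {0..1} u"
    unfolding u_def using Wp qS c
    by (intro continuous_intros continuous_on_compose2[OF continuous_U qc] continuous_on_compose2[OF continuous_weight qc])
      (auto simp: less_imp_neq[symmetric] order.strict_iff_not)
  define \<theta> where "\<theta> \<equiv> \<lambda>s. u s * norm (p s)"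
  have c\<theta>: "continuous_on {0..1} \<theta>" unfolding \<theta>_def by (intro continuous_intros cu p)
  have t_eq: "t \<sigma> = integral {0..\<sigma>} \<theta>" if \<sigma>: "\<sigma> \<in> {0..1}" for \<sigma>
  proof -
    have "(\<lambda>s. norm (g s)) absolutely_integrable_on {0..1}"
      using absolutely_integrable_norm[OF primitive_onD(1)[OF H1_derivD(2)[OF qg]]] by (simp add: o_def)
    from absolutely_integrable_bounded_bilinear[OF bounded_bilinear_mult cu this]
    have "(\<lambda>s. u s * norm (g s)) absolutely_integrable_on {0..1}" .
    then have "(\<lambda>s. u s * norm (g s)) absolutely_integrable_on {0..\<sigma>}"
      by (rule absolutely_integrable_on_subintervalI) (use \<sigma> in auto)
    then have "integrable (lebesgue_on {0..\<sigma>}) (\<lambda>s. u s * norm (g s))"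
      by (rule absolutely_integrable_imp_integrable) auto
    then have "(LINT s|lebesgue_on {0..\<sigma>}. u s * norm (g s)) = integral {0..\<sigma>} (\<lambda>s. u s * norm (g s))"
      by (intro lebesgue_integral_eq_integral) auto
    also have "\<dots> = integral {0..\<sigma>} \<theta>"
      using p(2) \<sigma> by (intro integral_AE_cong_subinterval[where a = 0 and b = 1]) (auto simp: \<theta>_def)
    also have "(LINT s|lebesgue_on {0..\<sigma>}. u s * norm (g s)) = t \<sigma>"
      by (simp add: t_def time_of_def u_def g_def U_def W_def)
    finally show ?thesis .
  qed
  interpret reparametrization 0 1 t \<theta>
  proof
    fix s :: real assume s: "s \<in> {0..1}"
    show "(t has_real_derivative \<theta> s) (at s within {0..1})"
      using has_field_derivative_transform_within[OF integral_has_real_derivative[OF c\<theta> s], of 1 t] t_eq s by simp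
    show "\<theta> s > 0"
      unfolding \<theta>_def u_def using ppos[OF s] Wp[OF s] Up[OF s] c by (intro mult_pos_pos divide_pos_pos) auto
  qed simp
  have t0: "t 0 = 0" using t_eq[of 0] by simp
  have tT: "{t 0..t 1} = {0..T}" by (simp add: t0 T_def)
  note inv_in = inv_param_in[unfolded tT]
  have T: "T > 0" using strictly_increasing[of 0 1] t0 by (simp add: T_def)
  show "bij_betw t {0..1} {0..T}" using bij unfolding tT .
  have dx: "(x has_vector_derivative (1 / \<theta> (inv_param y)) *\<^sub>R p (inv_param y)) (at y within {0..T})"
    if "y \<in> {0..T}" for y
    unfolding x_def using has_vector_derivative_reparam[unfolded tT, OF that dq[OF inv_in[OF that]]] .
  have vel: "velocity T x y = (1 / \<theta> (inv_param y)) *\<^sub>R p (inv_param y)" if "y \<in> {0..T}" for y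
    by (rule velocity_eq[OF T that dx[OF that]])
  have xS: "x y \<in> S" if "y \<in> {0..T}" for y
    using qS inv_in[OF that] by (simp add: x_def)
  have speed: "(norm (velocity T x y))\<^sup>2 = c ^ 4 * W (x y) / (U (x y))\<^sup>2" if y: "y \<in> {0..T}" for y
  proof -
    define s where "s = inv_param y"
    have s: "s \<in> {0..1}" using inv_in[OF y] by (simp add: s_def)
    have "norm (velocity T x y) = norm (p s) / \<theta> s"
      using speed_pos[OF s] by (simp add: vel[OF y] s_def[symmetric])
    \<comment> \<open>\<open>\<theta>\<close> is proportional to \<open>norm (p s)\<close>, so the
      speed of \<open>x\<close> depends on the position only.\<close>
    also have "\<dots> = c\<^sup>2 * sqrt (W (q s)) / U (q s)"
      using ppos[OF s] Wp[OF s] Up[OF s] c by (simp add: \<theta>_def u_def)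
    finally show ?thesis
      using Wp[OF s] by (simp add: x_def s_def[symmetric] power_divide power_mult_distrib)
  qed
  note lorentz = lorentz_factor[OF xS norm_ge_zero speed]
  show 1: "\<forall>y\<in>{0..T}. x y \<in> S \<and> norm (velocity T x y) < c"
    using xS lorentz(1) by blast
  show "energy_conservation m c V h T x"
    unfolding energy_conservation_def
  proof
    fix y assume y: "y \<in> {0..T}"
    show "m * c\<^sup>2 / sqrt (1 - (norm (velocity T x y))\<^sup>2 / c\<^sup>2) - V (x y) = h + m * c\<^sup>2"
      unfolding lorentz(2)[OF y y] using mc2_pos U_pos[OF xS[OF y]] m c by (simp add: U_def)
  qed
  have mom: "momentum m c T x y = (1 / (2 * sqrt E)) *\<^sub>R ((2 * W (q (inv_param y))) *\<^sub>R p (inv_param y))"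
    if y: "y \<in> {0..T}" for y
  proof -
    define s where "s = inv_param y"
    have s: "s \<in> {0..1}" using inv_in[OF y] by (simp add: s_def)
    \<comment> \<open>The Lorentz factor \<open>U / (m * c^2)\<close> cancels the \<open>U\<close>
      in \<open>\<theta>\<close>. What remains is \<open>sqrt W / norm p\<close>, that is
      \<open>W / sqrt E\<close>, a constant multiple of the Lagrangian momentum.\<close>
    have "m / (m * c\<^sup>2 / U (q s)) * (1 / \<theta> s) = 1 / (2 * sqrt E) * (2 * W (q s))"
      unfolding sqE[OF s] \<theta>_def u_def
      using ppos[OF s] Wp[OF s] Up[OF s] c m by (simp add: field_simps)
    moreover have "momentum m c T x y = (m / (m * c\<^sup>2 / U (q s)) * (1 / \<theta> s)) *\<^sub>R p s"
      unfolding momentum_def lorentz(2)[OF y y] unfolding vel[OF y] by (simp add: x_def s_def)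
    ultimately show ?thesis by (simp add: s_def)
  qed
  have dmom: "(momentum m c T x has_vector_derivative gradV (x y)) (at y within {0..T})" if y: "y \<in> {0..T}" for y
  proof -
    define s where "s = inv_param y"
    have s: "s \<in> {0..1}" using inv_in[OF y] by (simp add: s_def)
    have "((\<lambda>y. (1 / (2 * sqrt E)) *\<^sub>R ((2 * W (q (inv_param y))) *\<^sub>R p (inv_param y))) has_vector_derivative
       (1 / (2 * sqrt E)) *\<^sub>R (1 / \<theta> s) *\<^sub>R ((norm (p s))\<^sup>2 *\<^sub>R G (q s))) (at y within {0..T})"
      using has_vector_derivative_reparam[unfolded tT, OF y EL[OF inv_in[OF y]]]
      unfolding s_def by (intro bounded_linear.has_vector_derivative[OF bounded_linear_scaleR_right])
    \<comment> \<open>One factor \<open>norm p\<close> cancels against \<open>sqrt E\<close>, the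
      other against \<open>\<theta>\<close>, and the factor \<open>2 * U / c^2\<close> of
      \<open>G\<close> absorbs the rest; the force is exactly \<open>gradV\<close>.\<close>
    moreover have eq: "1 / (2 * sqrt E) * (1 / \<theta> s) * (norm (p s))\<^sup>2 * (2 * U (q s) / c\<^sup>2) = 1"
      unfolding sqE[OF s] \<theta>_def u_def
      using ppos[OF s] Wp[OF s] Up[OF s] c by (simp add: field_simps power2_eq_square)
    have "(1 / (2 * sqrt E)) *\<^sub>R (1 / \<theta> s) *\<^sub>R ((norm (p s))\<^sup>2 *\<^sub>R G (q s)) = gradV (x y)"
      unfolding G_def scaleR_scaleR mult.assoc[symmetric] eq by (simp add: x_def s_def)
    ultimately show ?thesis
      using has_vector_derivative_transform[OF y mom] by simp
  qed
  show "periodic_solution m c \<Omega> gradV T x"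
    unfolding periodic_solution_def
  proof (intro conjI ballI T)
    have inv: "inv_param 0 = 0" "inv_param T = 1"
      using inv_param_t[of 0] inv_param_t[of 1] by (auto simp: t0 T_def)
    show "x 0 = x T" using q01 by (simp add: x_def inv)
    have "\<theta> 0 = \<theta> 1" using q01 p01 by (simp add: \<theta>_def u_def)
    then show "velocity T x 0 = velocity T x T"
      using vel[of 0] vel[of T] T p01 by (simp add: inv)
    fix y assume y: "y \<in> {0..T}"
    show "x y \<in> \<Omega>" using xS[OF y] S_subset by blast
    show "x differentiable at y within {0..T}" using dx[OF y] by (rule differentiableI_vector)
    show "norm (velocity T x y) < c" using 1 y by blast
    show "(momentum m c T x has_vector_derivative gradV (x y)) (at y within {0..T})" by (rule dmom[OF y])
  qed
qed

section \<open>From periodic solutions to critical points\<close>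

lemma critical_point_of_solution:
  assumes xS: "\<forall>t\<in>{0..T}. x t \<in> S" and nonconst: "\<not> x constant_on {0..T}"
    and sol: "periodic_solution m c \<Omega> gradV T x" and cons: "energy_conservation m c V h T x"
  shows "\<exists>!lam. lam > 0 \<and> param_of m c V h lam x T = 1"
    and "\<And>lam. lam > 0 \<Longrightarrow> param_of m c V h lam x T = 1 \<Longrightarrow>
      bij_betw (param_of m c V h lam x) {0..T} {0..1} \<and>
      (\<lambda>\<sigma>. x (the_inv_into {0..T} (param_of m c V h lam x) \<sigma>)) \<in> Lambda_h \<Omega> V h \<and>
      \<not> (\<lambda>\<sigma>. x (the_inv_into {0..T} (param_of m c V h lam x) \<sigma>)) constant_on {0..1} \<and>
      critical_point m c \<Omega> V h (\<lambda>\<sigma>. x (the_inv_into {0..T} (param_of m c V h lam x) \<sigma>))"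
proof -
  have T: "T > 0" and dx: "\<And>t. t \<in> {0..T} \<Longrightarrow> x differentiable (at t within {0..T})"
    and slow: "\<And>t. t \<in> {0..T} \<Longrightarrow> norm (velocity T x t) < c"
    and dmom: "\<And>t. t \<in> {0..T} \<Longrightarrow> (momentum m c T x has_vector_derivative gradV (x t)) (at t within {0..T})"
    and x0T: "x 0 = x T" and v0T: "velocity T x 0 = velocity T x T"
    using sol unfolding periodic_solution_def by blast+
  have vel: "(x has_vector_derivative velocity T x t) (at t within {0..T})" if "t \<in> {0..T}" for t
    unfolding velocity_def using dx[OF that] by (simp add: vector_derivative_works)
  have xc: "continuous_on {0..T} x"
    unfolding continuous_on_eq_continuous_within using vel has_vector_derivative_continuous by blast
  have Wp: "W (x t) > 0" and Up: "U (x t) > 0" if "t \<in> {0..T}" for t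
    using W_pos U_pos xS that by blast+
  define r where "r \<equiv> \<lambda>t. W (x t) / U (x t)"
  have rc: "continuous_on {0..T} r"
    unfolding r_def using Up xS
    by (intro continuous_intros continuous_on_compose2[OF continuous_U xc] continuous_on_compose2[OF continuous_weight xc])
      force+
  have rp: "r t > 0" if "t \<in> {0..T}" for t using Wp[OF that] Up[OF that] by (simp add: r_def)
  define I where "I = integral {0..T} r"
  have I: "I > 0"
  proof -
    have r0: "r t \<ge> 0" if "t \<in> {0..T}" for t using rp[OF that] by simp
    have "I \<ge> 0"
      unfolding I_def by (intro integral_nonneg integrable_continuous_real rc r0)
    moreover have "0 \<in> {0..T}" using T by simp
    then have "I \<noteq> 0"
      unfolding I_def using integral_eq_0_iff[OF rc T r0] rp[of 0] by (metis less_irrefl)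
    ultimately show ?thesis by simp
  qed
  have param_eq: "param_of m c V h lam x y = c\<^sup>2 / sqrt (2 * lam) * integral {0..y} r" if y: "y \<in> {0..T}" for lam y
  proof -
    have "(LINT s|lebesgue_on {0..y}. r s) = integral {0..y} r"
      using y by (intro lebesgue_integral_eq_integral continuous_imp_integrable_real continuous_on_subset[OF rc]) auto
    then show ?thesis by (simp add: param_of_def r_def U_def W_def)
  qed
  \<comment> \<open>The integral \<open>I\<close> does not involve \<open>lam\<close>, so the
    normalization reads \<open>sqrt (2 * lam) = c^2 * I\<close> and has a single positive
    solution.\<close>
  have param_T: "param_of m c V h lam x T = 1 \<longleftrightarrow> lam = (c\<^sup>2 * I)\<^sup>2 / 2" if "lam > 0" for lam
  proof -
    have "param_of m c V h lam x T = 1 \<longleftrightarrow> sqrt (2 * lam) = c\<^sup>2 * I"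
      using param_eq[of T lam] T that by (auto simp: I_def field_simps)
    also have "\<dots> \<longleftrightarrow> 2 * lam = (c\<^sup>2 * I)\<^sup>2"
      using that I c by (metis less_imp_le mult_nonneg_nonneg real_sqrt_pow2 real_sqrt_unique zero_le_power2 zero_le_numeral)
    finally show ?thesis by auto
  qed
  show "\<exists>!lam. lam > 0 \<and> param_of m c V h lam x T = 1"
    using param_T I c by (intro ex1I[of _ "(c\<^sup>2 * I)\<^sup>2 / 2"]) auto
  fix lam :: real assume lam: "lam > 0" and T1: "param_of m c V h lam x T = 1"
  define P where "P = param_of m c V h lam x"
  define \<rho> where "\<rho> \<equiv> \<lambda>t. c\<^sup>2 / sqrt (2 * lam) * r t"
  interpret reparametrization 0 T P \<rho>
  proof (rule reparametrization.intro)
    fix s assume s: "s \<in> {0..T}"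
    have "((\<lambda>y. c\<^sup>2 / sqrt (2 * lam) * integral {0..y} r) has_real_derivative \<rho> s) (at s within {0..T})"
      unfolding \<rho>_def by (intro DERIV_cmult integral_has_real_derivative rc s)
    then show "(P has_real_derivative \<rho> s) (at s within {0..T})"
      by (rule has_field_derivative_transform_within[of _ _ _ _ 1]) (use s param_eq in \<open>auto simp: P_def\<close>)
    show "\<rho> s > 0" unfolding \<rho>_def using rp[OF s] c lam by (intro mult_pos_pos divide_pos_pos) auto
  qed (rule T)
  have P0: "P 0 = 0" using param_eq[of 0 lam] T by (simp add: P_def)
  have PT1: "P T = 1" using T1 by (simp add: P_def)
  have PT: "{P 0..P T} = {0..1}" by (simp add: P0 PT1)
  note inv_in = inv_param_in[unfolded PT]
  define q where "q \<equiv> \<lambda>\<sigma>. x (inv_param \<sigma>)"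
  define p where "p \<equiv> \<lambda>\<sigma>. (1 / \<rho> (inv_param \<sigma>)) *\<^sub>R velocity T x (inv_param \<sigma>)"
  have dq: "(q has_vector_derivative p \<sigma>) (at \<sigma> within {0..1})" if "\<sigma> \<in> {0..1}" for \<sigma>
    unfolding q_def p_def using has_vector_derivative_reparam[unfolded PT, OF that vel[OF inv_in[OF that]]] .
  have qS: "\<forall>\<sigma>\<in>{0..1}. q \<sigma> \<in> S" using xS inv_in by (auto simp: q_def)
  have gamma: "m * c\<^sup>2 / sqrt (1 - (norm (velocity T x t))\<^sup>2 / c\<^sup>2) = U (x t)" if "t \<in> {0..T}" for t
    using cons that unfolding energy_conservation_def U_def by (auto simp: algebra_simps)
  have mom: "momentum m c T x t = (U (x t) / c\<^sup>2) *\<^sub>R velocity T x t" if "t \<in> {0..T}" for t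
  proof -
    have "m / sqrt (1 - (norm (velocity T x t))\<^sup>2 / c\<^sup>2) = U (x t) / c\<^sup>2"
      unfolding gamma[OF that, symmetric] using c by simp
    then show ?thesis by (simp add: momentum_def)
  qed
  \<comment> \<open>The factor is \<open>2 * sqrt E\<close> with \<open>E = 2 * lam\<close>: the
    weight in \<open>\<rho>\<close> cancels \<open>W\<close> and leaves \<open>U / c^2\<close>, the
    coefficient of the velocity in the relativistic momentum.\<close>
  define F where "F \<equiv> \<lambda>\<sigma>. (2 * sqrt (2 * lam)) *\<^sub>R momentum m c T x (inv_param \<sigma>)"
  have F: "(2 * W (q \<sigma>)) *\<^sub>R p \<sigma> = F \<sigma>" if \<sigma>: "\<sigma> \<in> {0..1}" for \<sigma>
  proof -
    define t where "t = inv_param \<sigma>"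
    have t: "t \<in> {0..T}" using inv_in[OF \<sigma>] by (simp add: t_def)
    have "2 * W (x t) * (1 / \<rho> t) = 2 * sqrt (2 * lam) * (U (x t) / c\<^sup>2)"
      unfolding \<rho>_def r_def using Wp[OF t] Up[OF t] c lam by (simp add: field_simps)
    then show ?thesis
      unfolding F_def p_def q_def t_def[symmetric] mom[OF t] by simp
  qed
  have dF: "(F has_vector_derivative (norm (p \<sigma>))\<^sup>2 *\<^sub>R G (q \<sigma>)) (at \<sigma> within {0..1})" if \<sigma>: "\<sigma> \<in> {0..1}" for \<sigma>
  proof -
    define t where "t = inv_param \<sigma>"
    have t: "t \<in> {0..T}" using inv_in[OF \<sigma>] by (simp add: t_def)
    have "(F has_vector_derivative (2 * sqrt (2 * lam)) *\<^sub>R (1 / \<rho> t) *\<^sub>R gradV (x t)) (at \<sigma> within {0..1})"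
      unfolding F_def t_def
      by (intro bounded_linear.has_vector_derivative[OF bounded_linear_scaleR_right]
          has_vector_derivative_reparam[unfolded PT] \<sigma> dmom inv_in)
    moreover have "(norm (p \<sigma>))\<^sup>2 = (norm (velocity T x t))\<^sup>2 / (\<rho> t)\<^sup>2"
      by (simp add: p_def t_def power_divide)
    then have p2: "(norm (p \<sigma>))\<^sup>2 = (c ^ 4 * W (x t) / (U (x t))\<^sup>2) / (\<rho> t)\<^sup>2"
      using speed_of_energy[OF _ norm_ge_zero slow[OF t] gamma[OF t]] xS t by simp
    \<comment> \<open>Energy conservation fixes the speed, and with the definition of
      \<open>\<rho>\<close> this amounts to \<open>W(q) |p|^2 = 2 * lam\<close>.\<close>
    have eq: "(norm (p \<sigma>))\<^sup>2 * (2 * U (x t) / c\<^sup>2) = 2 * sqrt (2 * lam) * (1 / \<rho> t)"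
    proof -
      define l where "l = sqrt (2 * lam)"
      have "l > 0" using lam by (simp add: l_def)
      then show ?thesis
        unfolding p2 \<rho>_def r_def l_def[symmetric] using Wp[OF t] Up[OF t] c
        by (simp add: field_simps power2_eq_square power4_eq_xxxx)
    qed
    have "(2 * sqrt (2 * lam)) *\<^sub>R (1 / \<rho> t) *\<^sub>R gradV (x t) = (norm (p \<sigma>))\<^sup>2 *\<^sub>R G (q \<sigma>)"
      unfolding G_def scaleR_scaleR eq[symmetric] by (simp add: q_def t_def)
    ultimately show ?thesis by simp
  qed
  have EL: "((\<lambda>\<sigma>. (2 * W (q \<sigma>)) *\<^sub>R p \<sigma>) has_vector_derivative (norm (p \<sigma>))\<^sup>2 *\<^sub>R G (q \<sigma>)) (at \<sigma> within {0..1})"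
    if "\<sigma> \<in> {0..1}" for \<sigma>
    using has_vector_derivative_transform[OF that F dF[OF that]] .
  have qc: "continuous_on {0..1} q"
    unfolding continuous_on_eq_continuous_within using dq has_vector_derivative_continuous by blast
  have Wq: "W (q \<sigma>) > 0" if "\<sigma> \<in> {0..1}" for \<sigma> using qS W_pos that by blast
  have "continuous_on {0..1} F"
    unfolding continuous_on_eq_continuous_within using dF has_vector_derivative_continuous by blast
  \<comment> \<open>A solution is only assumed differentiable, so continuity of \<open>p\<close>
    cannot be read off the velocity. It comes from \<open>F\<close>, which is differentiable by the
    equation of motion.\<close>
  then have "continuous_on {0..1} (\<lambda>\<sigma>. (1 / (2 * W (q \<sigma>))) *\<^sub>R F \<sigma>)"
    using qS Wq by (intro continuous_intros continuous_on_compose2[OF continuous_weight qc]) force+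
  then have pc: "continuous_on {0..1} p"
  proof (rule continuous_on_eq)
    fix \<sigma> :: real assume \<sigma>: "\<sigma> \<in> {0..1}"
    show "(1 / (2 * W (q \<sigma>))) *\<^sub>R F \<sigma> = p \<sigma>" using Wq[OF \<sigma>] by (simp add: F[OF \<sigma>, symmetric])
  qed
  have inv: "inv_param 0 = 0" "inv_param 1 = T"
    using inv_param_t[of 0] inv_param_t[of T] T P0 PT1 by auto
  have q01: "q 0 = q 1" using x0T by (simp add: q_def inv)
  have p01: "p 0 = p 1" using x0T v0T by (simp add: p_def inv \<rho>_def r_def)
  have qp: "H1_deriv q p"
    unfolding H1_deriv_def
    using square_integrable_01_continuous[OF pc] primitive_on_of_has_vector_derivative[OF dq pc] by simp
  have ql: "q \<in> loops_in S" using H1_deriv_imp_H1[OF qp] q01 qS by (simp add: loops_in_def)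
  have "has_H1_differential (energy W) (\<lambda>_. 0) (loops_in S) q"
    by (rule has_H1_differential_zero[OF ql qp first_variation_eq_0_of_euler_lagrange[OF qp qS pc EL q01 p01]])
  then have crit: "critical_point m c \<Omega> V h q"
    unfolding critical_point_def energy_h_eq Lambda_h_eq using ql by blast
  have "\<not> q constant_on {0..1}"
  proof
    assume "q constant_on {0..1}"
    then obtain k where k: "\<forall>\<sigma>\<in>{0..1}. q \<sigma> = k" by (auto simp: constant_on_def)
    have "x t = k" if t: "t \<in> {0..T}" for t
    proof -
      have "P t \<in> {0..1}" using t image PT by blast
      with k inv_param_t[OF t] show ?thesis unfolding q_def by metis
    qed
    with nonconst show False by (auto simp: constant_on_def)
  qed
  with crit ql bij show "bij_betw (param_of m c V h lam x) {0..T} {0..1} \<and>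
      (\<lambda>\<sigma>. x (the_inv_into {0..T} (param_of m c V h lam x) \<sigma>)) \<in> Lambda_h \<Omega> V h \<and>
      \<not> (\<lambda>\<sigma>. x (the_inv_into {0..T} (param_of m c V h lam x) \<sigma>)) constant_on {0..1} \<and>
      critical_point m c \<Omega> V h (\<lambda>\<sigma>. x (the_inv_into {0..T} (param_of m c V h lam x) \<sigma>))"
    unfolding Lambda_h_eq PT by (simp add: q_def P_def)
qed

end

theorem proposition2p1:
  fixes m c h :: real
    and \<Omega> :: "(real ^ 'n) set"
    and V :: "real ^ 'n \<Rightarrow> real"
    and gradV :: "real ^ 'n \<Rightarrow> real ^ 'n"
  assumes "m > 0" and "c > 0"
    and "open \<Omega>"
    and "\<And>x. x \<in> \<Omega> \<Longrightarrow> GDERIV V x :> gradV x"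
    and "continuous_on \<Omega> gradV"
    and "Omega_h \<Omega> V h \<noteq> {}"
  shows
    "(\<forall>q. critical_point m c \<Omega> V h q \<and> \<not> q constant_on {0..1} \<longrightarrow>
        (let t = time_of m c V h q;
             T = t 1;
             \<zeta> = the_inv_into {0..1} t;
             x = (\<lambda>s. q (\<zeta> s))
         in bij_betw t {0..1} {0..T} \<and>
            (\<forall>s\<in>{0..T}. x s \<in> Omega_h \<Omega> V h \<and> norm (velocity T x s) < c) \<and>
            periodic_solution m c \<Omega> gradV T x \<and>
            energy_conservation m c V h T x)) \<and>
     (\<forall>T x. (\<forall>t\<in>{0..T}. x t \<in> Omega_h \<Omega> V h) \<and> \<not> x constant_on {0..T} \<and>
        periodic_solution m c \<Omega> gradV T x \<and> energy_conservation m c V h T x \<longrightarrow>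
        (\<exists>!lam. lam > 0 \<and> param_of m c V h lam x T = 1) \<and>
        (\<forall>lam>0. param_of m c V h lam x T = 1 \<longrightarrow>
          (let \<tau> = the_inv_into {0..T} (param_of m c V h lam x);
               q = (\<lambda>\<sigma>. x (\<tau> \<sigma>))
           in bij_betw (param_of m c V h lam x) {0..T} {0..1} \<and>
              q \<in> Lambda_h \<Omega> V h \<and> \<not> q constant_on {0..1} \<and>
              critical_point m c \<Omega> V h q)))"
proof -
  interpret relativistic_potential m c h \<Omega> V gradV
    using assms by unfold_locales
  show ?thesis
    unfolding Let_def
    by (intro conjI allI impI; (elim conjE)?)
      (use solution_of_critical_point critical_point_of_solution in blast)+
qed

end
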